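(* For $k\in\mathbb{N}$ let $W_k=\{\overline{Tr_{2^k}}(A): A\in\mathcal{S}\cup\mathcal{T}\}\subset\mathbb{R}$. Then: (1) the smallest limit point of $W_1$ (the set of values $\overline{Tr_2}(A)$) is $6$; (2) for every positive integer $k>1$, the smallest limit point of $W_k$ is greater than or equal to $5^{2^{k-1}}$.
   Context: $\mathbb{N}$ denotes the positive integers. Trace measures: for a real $n\times n$ matrix $A$ with eigenvalues $\beta_1,\dots,\beta_n$ (with multiplicity) and $k\in\mathbb{N}$, $Tr_k(A)=\sum_{i=1}^n\beta_i^k$ and $\overline{Tr_k}(A)=\frac{1}{n}\sum_{i=1}^n\beta_i^k$. Symmetrizable: a real square matrix $A$ is symmetrizable if there is a diagonal matrix $D$ with all diagonal entries positive such that $D^{-1}AD$ is a real symmetric matrix. Positive definite: a matrix is called positive definite if and only if all of its eigenvalues are totally positive, where an eigenvalue is totally positive if all of its conjugates (over $\mathbb{Q}$) are positive real numbers. Upper/lower diagonal: an $n\times n$ matrix $(a_{ij})$ has non-zero upper diagonal if $a_{i,i+1}\neq 0$ for all $1\le i\le n-1$, and non-zero lower diagonal if $a_{i+1,i}\ne 0$ for all $1\le i\le n-1$. Rational cycle condition: an $n\times n$ real matrix $(s_{ij})$ satisfies it if for every finite sequence $i_1,\dots,i_k\in\{1,\dots,n\}$ with $3\le k\le n$ one has $s_{i_1i_2}s_{i_2i_3}\cdots s_{i_ki_1}\in\mathbb{Q}$. $\mathcal{S}_n$ is the set of all $n\times n$ integer matrices that are symmetrizable and positive definite with non-zero upper and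 lower diagonal, and $\mathcal{S}=\bigcup_{n\in\mathbb{N}}\mathcal{S}_n$. $\mathcal{T}_n$ is the set of all $n\times n$ real symmetric matrices that are positive definite, have non-zero upper diagonal, have all entries in $\{\pm\sqrt{a}: a\in\mathbb{N}\}\cup\{0\}$, and satisfy the rational cycle condition, and $\mathcal{T}=\bigcup_{n\in\mathbb{N}}\mathcal{T}_n$. *)

theory Defs
  imports
    "HOL-Analysis.Analysis"
    "HOL-Computational_Algebra.Computational_Algebra"
    "Jordan_Normal_Form.Char_Poly"
begin

text \<open>
  Matrices are those of \<open>Jordan_Normal_Form\<close>, whose dimension is a value and not a type;
  row and column indices run over \<open>0, \<dots>, n - 1\<close>.
\<close>

abbreviation complex_mat :: "real mat \<Rightarrow> complex mat" where
  "complex_mat A \<equiv> map_mat complex_of_real A"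

text \<open>\<open>proots\<close> counts each complex root of the characteristic polynomial with multiplicity.\<close>

definition Tr :: "nat \<Rightarrow> real mat \<Rightarrow> complex" where
  "Tr k A = (\<Sum>\<beta>\<in>#proots (char_poly (complex_mat A)). \<beta> ^ k)"

definition mean_Tr :: "nat \<Rightarrow> real mat \<Rightarrow> complex" where
  "mean_Tr k A = Tr k A / of_nat (dim_row A)"

definition symmetrizable :: "real mat \<Rightarrow> bool" where
  "symmetrizable A \<longleftrightarrow>
     (\<exists>n D D'. A \<in> carrier_mat n n \<and> D \<in> carrier_mat n n \<and> D' \<in> carrier_mat n n \<and>
        diagonal_mat D \<and> (\<forall>i<n. D $$ (i, i) > 0) \<and>
        inverts_mat D D' \<and> inverts_mat D' D \<and>
        transpose_mat (D' * A * D) = D' * A * D)"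

text \<open>
  An irreducible rational polynomial vanishing at \<open>z\<close> is, up to a unit, the minimal polynomial
  of \<open>z\<close> over the rationals, so its complex roots are exactly the conjugates of \<open>z\<close>.
\<close>

definition conjugate_over_Q :: "complex \<Rightarrow> complex \<Rightarrow> bool" where
  "conjugate_over_Q z w \<longleftrightarrow>
     (\<exists>p :: rat poly. irreducible p \<and> poly (map_poly of_rat p) z = 0 \<and> poly (map_poly of_rat p) w = 0)"

text \<open>
  Conjugates are defined for algebraic numbers only; without that conjunct every transcendental
  number would be totally positive vacuously.
\<close>

definition totally_positive :: "complex \<Rightarrow> bool" where
  "totally_positive z \<longleftrightarrow>
     algebraic z \<and> (\<forall>w. conjugate_over_Q z w \<longrightarrow> w \<in> \<real> \<and> Re w > 0)"

definition positive_definite :: "real mat \<Rightarrow> bool" where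
  "positive_definite A \<longleftrightarrow> (\<forall>\<beta>. eigenvalue (complex_mat A) \<beta> \<longrightarrow> totally_positive \<beta>)"

definition nonzero_upper_diagonal :: "real mat \<Rightarrow> bool" where
  "nonzero_upper_diagonal A \<longleftrightarrow> (\<forall>i. i + 1 < dim_row A \<longrightarrow> A $$ (i, i + 1) \<noteq> 0)"

definition nonzero_lower_diagonal :: "real mat \<Rightarrow> bool" where
  "nonzero_lower_diagonal A \<longleftrightarrow> (\<forall>i. i + 1 < dim_row A \<longrightarrow> A $$ (i + 1, i) \<noteq> 0)"

text \<open>The sequences range over all words in the indices; repetitions are allowed.\<close>

definition rational_cycle_condition :: "real mat \<Rightarrow> bool" where
  "rational_cycle_condition A \<longleftrightarrow>
     (\<forall>is. set is \<subseteq> {..<dim_row A} \<and> 3 \<le> length is \<and> length is \<le> dim_row A \<longrightarrow>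
        (\<Prod>j<length is. A $$ (is ! j, is ! ((j + 1) mod length is))) \<in> \<rat>)"

definition S_n :: "nat \<Rightarrow> real mat set" where
  "S_n n = {A \<in> carrier_mat n n.
     (\<forall>i<n. \<forall>j<n. A $$ (i, j) \<in> \<int>) \<and>
     symmetrizable A \<and> positive_definite A \<and>
     nonzero_upper_diagonal A \<and> nonzero_lower_diagonal A}"

definition T_n :: "nat \<Rightarrow> real mat set" where
  "T_n n = {A \<in> carrier_mat n n.
     transpose_mat A = A \<and> positive_definite A \<and> nonzero_upper_diagonal A \<and>
     (\<forall>i<n. \<forall>j<n. A $$ (i, j) \<in>
        {sqrt (real a) | a :: nat. a \<ge> 1} \<union> {- sqrt (real a) | a :: nat. a \<ge> 1} \<union> {0}) \<and>
     rational_cycle_condition A}"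

definition S_all :: "real mat set" where
  "S_all = (\<Union>n\<in>{1..}. S_n n)"

definition T_all :: "real mat set" where
  "T_all = (\<Union>n\<in>{1..}. T_n n)"

text \<open>
  \<open>mean_Tr\<close> takes real values on real matrices, because non-real roots of a real polynomial
  come in conjugate pairs; hence every matrix below contributes its value.
\<close>

definition W :: "nat \<Rightarrow> real set" where
  "W k = {x. \<exists>A \<in> S_all \<union> T_all. complex_of_real x = mean_Tr (2 ^ k) A}"

definition smallest_limit_point :: "real set \<Rightarrow> real \<Rightarrow> bool" where
  "smallest_limit_point X m \<longleftrightarrow> m islimpt X \<and> (\<forall>x. x islimpt X \<longrightarrow> m \<le> x)"

end

theory Submission
  imports
    Defs
    "Jordan_Normal_Form.Schur_Decomposition"
    "HOL-Computational_Algebra.Field_as_Ring"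
begin

text \<open>
  Every matrix \<open>A\<close> in question is similar to a real symmetric matrix \<open>S\<close> whose entries have integer
  squares: for an integer symmetrizable matrix conjugate by the symmetrizing diagonal matrix, and in
  the other case take \<open>A\<close> itself. Hence \<open>Tr k A\<close> is the trace of the \<open>k\<close>-th power of \<open>S\<close>, and \<open>Tr 2 A\<close> is the
  sum of the squares of the entries of \<open>S\<close>.

  The heart of the matter is the bound \<open>trace S \<ge> 2 n - 1\<close> (\<open>trace_lower_bound_path\<close>). If no diagonal
  entry is \<open>1\<close>, all of them are at least \<open>2\<close>. Otherwise eliminate a row and column with diagonal entry \<open>1\<close>.
  The Schur complement is again positive definite, and its entries again have integer
  squares, because the cycle condition turns the cross terms \<open>s i j * s j p * s p i\<close> into integers.
  The graph of the nonzero entries may fall apart, but each new component contains a former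
  neighbour of the pivot, and each neighbour \<open>j\<close> contributed \<open>(s p j)\<^sup>2 \<ge> 1\<close> to the trace; so the number
  of components is paid for. From \<open>(x - 2)\<^sup>2 \<ge> 0\<close> on the diagonal and the \<open>2 (n - 1)\<close> nonzero entries next
  to it one gets \<open>Tr 2 A \<ge> 6 n - 6\<close> for \<open>n \<ge> 3\<close> (\<open>square_sum_lower_bound\<close>).

  The Cauchy-Schwarz inequality, applied repeatedly to powers of \<open>S\<close>, bounds the mean of the
  \<open>2 ^ k\<close>-th powers below by the \<open>2 ^ (k - 1)\<close>-th power of the mean of the squares. So a bound on
  the mean that is less than \<open>6 ^ 2 ^ (k - 1)\<close> bounds both the size and the entries of \<open>S\<close>, and
  leaves only finitely many \<open>S\<close> (\<open>finite_W_below\<close>); no limit point lies below \<open>6 ^ 2 ^ (k - 1)\<close>.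

  Limit points exist because of the matrices of paths, with \<open>2\<close> on the diagonal and \<open>1\<close> next to it.
  For \<open>k = 1\<close> their means are \<open>6 - 2 / n\<close>, which converge to \<open>6\<close>. For larger \<open>k\<close> the trace of the
  power is strictly superadditive in the length of the path, so along \<open>n = 2 ^ j\<close> the means
  increase strictly while staying bounded. The set of limit points is closed and bounded below,
  hence has a least element.
\<close>

section \<open>The trace of a positive definite form with integral squares\<close>

definition pos_def_on :: "'a set \<Rightarrow> ('a \<Rightarrow> 'a \<Rightarrow> real) \<Rightarrow> bool" where
  "pos_def_on V s \<longleftrightarrow>
     (\<forall>x. (\<exists>i\<in>V. x i \<noteq> 0) \<longrightarrow> 0 < (\<Sum>i\<in>V. \<Sum>j\<in>V. s i j * x i * x j))"

definition sym_square_integral_on :: "'a set \<Rightarrow> ('a \<Rightarrow> 'a \<Rightarrow> real) \<Rightarrow> bool" where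
  "sym_square_integral_on V s \<longleftrightarrow> (\<forall>i\<in>V. \<forall>j\<in>V. s i j = s j i \<and> (s i j)\<^sup>2 \<in> \<int>)"

text \<open>
  This is the form in which the cycle condition survives the elimination of a variable: conjugation
  by the diagonal matrix of \<open>d\<close> makes the matrix rational, so that the factors \<open>d j / d i\<close> cancel along
  each cycle. Signs of \<open>d\<close> do not matter, and negative entries occur below.
\<close>

definition rational_up_to_scaling_on :: "'a set \<Rightarrow> ('a \<Rightarrow> 'a \<Rightarrow> real) \<Rightarrow> bool" where
  "rational_up_to_scaling_on V s \<longleftrightarrow>
     (\<exists>d. \<forall>i\<in>V. d i \<noteq> 0 \<and> (\<forall>j\<in>V. s i j * d j / d i \<in> \<rat>))"

text \<open>
  In the graph on \<open>V\<close> whose edges are the nonzero entries, these are the unions of connected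
  components. A set that meets each nonempty one of them therefore has at least as many elements as
  there are components, which is how components are counted here.
\<close>

definition decoupled_in :: "'a set \<Rightarrow> ('a \<Rightarrow> 'a \<Rightarrow> real) \<Rightarrow> 'a set \<Rightarrow> bool" where
  "decoupled_in V s U \<longleftrightarrow> U \<subseteq> V \<and> (\<forall>i\<in>U. \<forall>j\<in>V - U. s i j = 0)"

text \<open>
  The Schur complement for a pivot with \<open>s p p = 1\<close>.
\<close>

definition schur_at :: "'a \<Rightarrow> ('a \<Rightarrow> 'a \<Rightarrow> real) \<Rightarrow> 'a \<Rightarrow> 'a \<Rightarrow> real" where
  "schur_at p s i j = s i j - s i p * s p j"

lemma Rats_sq_Ints:
  fixes x :: real
  assumes "x \<in> \<rat>" "x\<^sup>2 \<in> \<int>"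
  shows "x \<in> \<int>"
proof -
  have "algebraic_int (sqrt (x\<^sup>2))"
    using assms(2) by (intro algebraic_int_sqrt int_imp_algebraic_int)
  moreover have "sqrt (x\<^sup>2) \<in> \<rat>" using assms(1) by simp
  ultimately have "\<bar>x\<bar> \<in> \<int>" using rational_algebraic_int_is_int[of "\<bar>x\<bar>"] by simp
  thus ?thesis by (cases "x \<ge> 0") auto
qed

text \<open>
  The form of the Schur complement at \<open>x\<close> is the original form at the extension of \<open>x\<close> to \<open>p\<close> that
  minimises it.
\<close>

lemma pos_def_on_schur_at:
  assumes fin: "finite V" and p: "p \<in> V" "s p p = 1"
    and sym: "sym_square_integral_on V s" and pd: "pos_def_on V s"
  shows "pos_def_on (V - {p}) (schur_at p s)"
  unfolding pos_def_on_def
proof (intro allI impI)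
  fix x :: "'a \<Rightarrow> real" assume "\<exists>i\<in>V - {p}. x i \<noteq> 0"
  then obtain k where k: "k \<in> V" "k \<noteq> p" "x k \<noteq> 0" by auto
  let ?W = "V - {p}"
  define c where "c = (\<Sum>j\<in>?W. s p j * x j)"
  define y where "y = x(p := - c)"
  have sp: "s i p = s p i" if "i \<in> V" for i
    using sym p that unfolding sym_square_integral_on_def by blast
  have row: "(\<Sum>j\<in>V. s i j * y i * y j) = s i p * y i * (-c) + (\<Sum>j\<in>?W. s i j * y i * x j)" for i
    by (subst sum.remove[OF fin p(1)]) (auto simp: y_def intro!: sum.cong)
  have "(\<Sum>i\<in>V. \<Sum>j\<in>V. s i j * y i * y j)
     = (s p p * (-c) * (-c) + (\<Sum>j\<in>?W. s p j * (-c) * x j))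
       + (\<Sum>i\<in>?W. s i p * x i * (-c) + (\<Sum>j\<in>?W. s i j * x i * x j))"
    unfolding row by (subst sum.remove[OF fin p(1)]) (auto simp: y_def intro!: sum.cong)
  also have "(\<Sum>j\<in>?W. s p j * (-c) * x j) = -c * c"
    unfolding c_def sum_distrib_left by (intro sum.cong) (auto simp: algebra_simps)
  also have "(\<Sum>i\<in>?W. s i p * x i * (-c) + (\<Sum>j\<in>?W. s i j * x i * x j))
      = -c * c + (\<Sum>i\<in>?W. \<Sum>j\<in>?W. s i j * x i * x j)"
  proof -
    have "(\<Sum>i\<in>?W. s i p * x i * (-c)) = (\<Sum>i\<in>?W. -c * (s p i * x i))"
      by (intro sum.cong) (auto simp: sp)
    also have "\<dots> = -c * c" unfolding sum_distrib_left[symmetric] c_def ..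
    finally show ?thesis by (simp only: sum.distrib)
  qed
  also have "s p p * (-c) * (-c) + -c * c + (-c * c + (\<Sum>i\<in>?W. \<Sum>j\<in>?W. s i j * x i * x j))
     = (\<Sum>i\<in>?W. \<Sum>j\<in>?W. s i j * x i * x j) - c * c" using p by simp
  also have "c * c = (\<Sum>i\<in>?W. \<Sum>j\<in>?W. s i p * s p j * x i * x j)"
    unfolding c_def sum_product by (intro sum.cong) (auto simp: sp)
  also have "(\<Sum>i\<in>?W. \<Sum>j\<in>?W. s i j * x i * x j) - \<dots>
      = (\<Sum>i\<in>?W. \<Sum>j\<in>?W. schur_at p s i j * x i * x j)"
    unfolding schur_at_def sum_subtractf[symmetric]
    by (intro sum.cong) (auto simp: algebra_simps)
  finally have "(\<Sum>i\<in>V. \<Sum>j\<in>V. s i j * y i * y j)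
     = (\<Sum>i\<in>?W. \<Sum>j\<in>?W. schur_at p s i j * x i * x j)" .
  moreover have "0 < (\<Sum>i\<in>V. \<Sum>j\<in>V. s i j * y i * y j)"
    using k by (intro pd[unfolded pos_def_on_def, rule_format] bexI[of _ k]) (auto simp: y_def)
  ultimately show "0 < (\<Sum>i\<in>?W. \<Sum>j\<in>?W. schur_at p s i j * x i * x j)" by simp
qed

lemma rational_up_to_scaling_on_schur_at:
  assumes p: "p \<in> V" and "rational_up_to_scaling_on V s"
  shows "rational_up_to_scaling_on (V - {p}) (schur_at p s)"
proof -
  obtain d where d: "\<And>i. i \<in> V \<Longrightarrow> d i \<noteq> 0"
    "\<And>i j. i \<in> V \<Longrightarrow> j \<in> V \<Longrightarrow> s i j * d j / d i \<in> \<rat>"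
    using assms(2) unfolding rational_up_to_scaling_on_def by blast
  have "schur_at p s i j * d j / d i \<in> \<rat>" if "i \<in> V" "j \<in> V" for i j
  proof -
    have "schur_at p s i j * d j / d i = s i j * d j / d i - (s i p * d p / d i) * (s p j * d j / d p)"
      using d(1)[OF p] d(1)[OF that(1)] by (simp add: schur_at_def field_simps)
    also have "\<dots> \<in> \<rat>" by (intro Rats_diff Rats_mult d(2) p that)
    finally show ?thesis .
  qed
  thus ?thesis unfolding rational_up_to_scaling_on_def using d(1) by (intro exI[of _ d]) auto
qed

text \<open>
  The scaling factors cancel around the triangle, so the product is rational; it is a root of
  \<open>X\<^sup>2 - m\<close> for an integer \<open>m\<close>, hence an integer.
\<close>

lemma triangle_product_Ints:
  assumes "sym_square_integral_on V s" "rational_up_to_scaling_on V s" "i \<in> V" "j \<in> V" "k \<in> V"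
  shows "s i j * s j k * s k i \<in> \<int>"
proof (rule Rats_sq_Ints)
  obtain d where d: "\<And>i. i \<in> V \<Longrightarrow> d i \<noteq> 0"
    "\<And>i j. i \<in> V \<Longrightarrow> j \<in> V \<Longrightarrow> s i j * d j / d i \<in> \<rat>"
    using assms(2) unfolding rational_up_to_scaling_on_def by blast
  have "s i j * s j k * s k i = (s i j * d j / d i) * (s j k * d k / d j) * (s k i * d i / d k)"
    using d(1) assms(3-) by (simp add: field_simps)
  also have "\<dots> \<in> \<rat>" by (intro Rats_mult d(2) assms(3-))
  finally show "s i j * s j k * s k i \<in> \<rat>" .
  have "(s i j)\<^sup>2 * (s j k)\<^sup>2 * (s k i)\<^sup>2 \<in> \<int>"
    using assms unfolding sym_square_integral_on_def by (intro Ints_mult) auto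
  thus "(s i j * s j k * s k i)\<^sup>2 \<in> \<int>" by (simp add: power_mult_distrib)
qed

lemma diagonal_Ints:
  assumes "sym_square_integral_on V s" "rational_up_to_scaling_on V s" "i \<in> V"
  shows "s i i \<in> \<int>"
proof (rule Rats_sq_Ints)
  obtain d where "d i \<noteq> 0" "s i i * d i / d i \<in> \<rat>"
    using assms unfolding rational_up_to_scaling_on_def by blast
  thus "s i i \<in> \<rat>" by simp
  show "(s i i)\<^sup>2 \<in> \<int>" using assms unfolding sym_square_integral_on_def by blast
qed

text \<open>
  In \<open>(s i j - s i p * s p j)\<^sup>2\<close> the only term that is not a product of squares of entries is twice a triangle
  product.
\<close>

lemma sym_square_integral_on_schur_at:
  assumes p: "p \<in> V" and s: "sym_square_integral_on V s" and r: "rational_up_to_scaling_on V s"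
  shows "sym_square_integral_on (V - {p}) (schur_at p s)"
proof -
  have sym: "s i j = s j i" if "i \<in> V" "j \<in> V" for i j
    using s that unfolding sym_square_integral_on_def by blast
  have sq: "(s i j)\<^sup>2 \<in> \<int>" if "i \<in> V" "j \<in> V" for i j
    using s that unfolding sym_square_integral_on_def by blast
  show ?thesis unfolding sym_square_integral_on_def
  proof (intro ballI conjI)
    fix i j assume ij: "i \<in> V - {p}" "j \<in> V - {p}"
    have V: "i \<in> V" "j \<in> V" using ij by auto
    show "schur_at p s i j = schur_at p s j i"
      using sym[OF V] sym[OF V(1) p] sym[OF V(2) p] by (simp add: schur_at_def)
    have "(schur_at p s i j)\<^sup>2
        = (s i j)\<^sup>2 - 2 * (s i j * s j p * s p i) + (s i p)\<^sup>2 * (s p j)\<^sup>2"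
      using sym[OF V(2) p] sym[OF V(1) p]
      by (simp add: schur_at_def power2_eq_square algebra_simps)
    thus "(schur_at p s i j)\<^sup>2 \<in> \<int>"
      using sq p V triangle_product_Ints[OF s r V p] by simp
  qed
qed

lemma diagonal_pos:
  assumes "finite V" "pos_def_on V s" "i \<in> V"
  shows "s i i > 0"
proof -
  let ?x = "\<lambda>j. if j = i then 1 else 0 :: real"
  have "0 < (\<Sum>k\<in>V. \<Sum>j\<in>V. s k j * ?x k * ?x j)"
    using assms(3) by (intro assms(2)[unfolded pos_def_on_def, rule_format] bexI[of _ i]) auto
  also have "\<dots> = (\<Sum>k\<in>V. if k = i then s i i else 0)"
    using assms by (intro sum.cong) (auto simp: if_distrib cong: if_cong)
  finally show ?thesis using assms by simp
qed

text \<open>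
  The chosen representatives of the components may be moved: the one in the component of \<open>p\<close> can be
  replaced by \<open>p\<close>.
\<close>

lemma rebase_hitting_set:
  assumes sym: "\<And>i j. i \<in> V \<Longrightarrow> j \<in> V \<Longrightarrow> s i j = s j i" and p: "p \<in> V"
    and fin: "finite R"
    and RV: "R \<subseteq> V" and hit: "\<And>U. decoupled_in V s U \<Longrightarrow> U \<noteq> {} \<Longrightarrow> U \<inter> R \<noteq> {}"
  obtains R' where "p \<in> R'" "R' \<subseteq> V" "card R' = card R"
    "\<And>U. decoupled_in V s U \<Longrightarrow> U \<noteq> {} \<Longrightarrow> U \<inter> R' \<noteq> {}"
proof (cases "p \<in> R")
  case True thus ?thesis using that RV hit by blast
next
  case False
  let ?K = "\<Inter>{U. decoupled_in V s U \<and> p \<in> U}"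
  have V: "decoupled_in V s V" by (simp add: decoupled_in_def)
  have "decoupled_in V s ?K" unfolding decoupled_in_def[of V s ?K]
  proof (intro conjI ballI)
    show "?K \<subseteq> V" using V p by blast
    fix i j assume i: "i \<in> ?K" and j: "j \<in> V - ?K"
    then obtain U where U: "decoupled_in V s U" "p \<in> U" "j \<notin> U" by auto
    with i j show "s i j = 0" by (auto simp: decoupled_in_def)
  qed
  moreover have "p \<in> ?K" by simp
  ultimately have "?K \<inter> R \<noteq> {}" by (intro hit) auto
  then obtain r where "r \<in> ?K \<inter> R" by (meson ex_in_conv)
  hence r: "r \<in> ?K" "r \<in> R" by (simp_all only: Int_iff)
  show ?thesis
  proof (rule that[of "insert p (R - {r})"])
    have "card (insert p (R - {r})) = Suc (card (R - {r}))" using False fin by simp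
    also have "\<dots> = card R" by (rule card_Suc_Diff1[OF fin r(2)])
    finally show "card (insert p (R - {r})) = card R" .
    fix U assume U: "decoupled_in V s U" "U \<noteq> {}"
    then obtain q where q: "q \<in> U" "q \<in> R" using hit by blast
    have "p \<in> U" if "r \<in> U"
    proof (rule ccontr)
      assume "p \<notin> U"
      moreover have "decoupled_in V s (V - U)"
        unfolding decoupled_in_def
      proof (intro conjI ballI)
        fix i j assume "i \<in> V - U" "j \<in> V - (V - U)"
        hence ij: "i \<in> V" "j \<in> V" "i \<notin> U" "j \<in> U" by auto
        have "s j i = 0" using U(1) ij unfolding decoupled_in_def by blast
        thus "s i j = 0" using sym[OF ij(1,2)] by simp
      qed blast
      ultimately have "r \<in> V - U" using r p by blast
      thus False using that by simp
    qed
    thus "U \<inter> insert p (R - {r}) \<noteq> {}" using q by blast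
  qed (use p RV in auto)
qed

text \<open>
  With \<open>R\<close> a system of representatives this says that the trace is at least \<open>2 n - c\<close>, where \<open>c\<close> is the
  number of components. The induction eliminates a pivot \<open>p\<close> that is itself a representative. In the
  Schur complement \<open>p\<close> is replaced by its neighbours \<open>N\<close>, so the bound drops by at most
  \<open>1 + card N\<close>; the trace drops by \<open>1\<close>, for \<open>p\<close>, and by the sum of the \<open>(s p j)\<^sup>2\<close>, which is at least
  \<open>card N\<close>.
\<close>

lemma trace_lower_bound:
  assumes "finite V" "pos_def_on V s" "sym_square_integral_on V s" "rational_up_to_scaling_on V s"
    and "R \<subseteq> V" and "\<And>U. decoupled_in V s U \<Longrightarrow> U \<noteq> {} \<Longrightarrow> U \<inter> R \<noteq> {}"
  shows "2 * real (card V) - real (card R) \<le> (\<Sum>i\<in>V. s i i)"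
  using assms
proof (induction "card V" arbitrary: V s R)
  case 0 thus ?case by simp
next
  case (Suc n V s R)
  note fin = Suc.prems(1) and pd = Suc.prems(2) and sq = Suc.prems(3) and rs = Suc.prems(4)
  have int: "s i i \<in> \<int>" "s i i > 0" if "i \<in> V" for i
    using diagonal_Ints[OF sq rs that] diagonal_pos[OF fin pd that] by auto
  show ?case
  proof (cases "\<exists>p\<in>V. s p p = 1")
    case False
    have "2 \<le> s i i" if i: "i \<in> V" for i
    proof -
      obtain m :: int where m: "s i i = of_int m" using int(1)[OF i] by (auto elim: Ints_cases)
      with int(2)[OF i] False i have "m > 0" "m \<noteq> 1" by auto
      thus ?thesis using m by simp
    qed
    hence "(\<Sum>i\<in>V. 2) \<le> (\<Sum>i\<in>V. s i i)" by (intro sum_mono)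
    thus ?thesis by simp
  next
    case True
    then obtain p where p: "p \<in> V" "s p p = 1" by blast
    let ?W = "V - {p}"
    have sym: "s i j = s j i" if "i \<in> V" "j \<in> V" for i j
      using sq that unfolding sym_square_integral_on_def by blast
    obtain R' where R': "p \<in> R'" "R' \<subseteq> V" "card R' = card R"
      and hit: "\<And>U. decoupled_in V s U \<Longrightarrow> U \<noteq> {} \<Longrightarrow> U \<inter> R' \<noteq> {}"
      by (rule rebase_hitting_set[OF sym p(1) finite_subset[OF Suc.prems(5) fin] Suc.prems(5,6)]) blast+
    define N where "N = {j \<in> ?W. s p j \<noteq> 0}"
    have IH: "2 * real (card ?W) - real (card (R' - {p} \<union> N)) \<le> (\<Sum>i\<in>?W. schur_at p s i i)"
    proof (rule Suc.hyps(1)[of ?W "schur_at p s"])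
      show "n = card ?W" using Suc.hyps(2) p fin by simp
      fix U assume U: "decoupled_in ?W (schur_at p s) U" "U \<noteq> {}"
      show "U \<inter> (R' - {p} \<union> N) \<noteq> {}"
      \<comment> \<open>Away from the neighbours of \<open>p\<close> the elimination changes nothing, so a decoupled set that
        avoids them was decoupled before.\<close>
      proof (cases "U \<inter> N = {}")
        case True
        have 0: "s i p = 0" if "i \<in> U" for i
        proof -
          have "i \<in> ?W" using U that by (auto simp: decoupled_in_def)
          thus ?thesis using True that sym[of p i] p unfolding N_def by auto
        qed
        have "s i j = 0" if "i \<in> U" "j \<in> V - U" for i j
        proof (cases "j = p")
          case False
          hence "schur_at p s i j = 0" using U(1) that by (auto simp: decoupled_in_def)
          thus ?thesis using 0[OF that(1)] by (simp add: schur_at_def)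
        qed (use 0 that in simp)
        hence "decoupled_in V s U" using U(1) by (auto simp: decoupled_in_def)
        hence "U \<inter> R' \<noteq> {}" using hit U(2) by blast
        moreover have "p \<notin> U" using U(1) by (auto simp: decoupled_in_def)
        ultimately show ?thesis by blast
      qed blast
    qed (use fin R' pos_def_on_schur_at[OF fin p sq pd] sym_square_integral_on_schur_at[OF p(1) sq rs]
          rational_up_to_scaling_on_schur_at[OF p(1) rs] in \<open>auto simp: N_def\<close>)
    have "card R > 0"
      using R' fin by (metis card_gt_0_iff emptyE finite_subset)
    hence card_R: "real (card R - 1) = real (card R) - 1" by simp
    have "card (R' - {p} \<union> N) \<le> card (R' - {p}) + card N" by (rule card_Un_le)
    also have "card (R' - {p}) = card R - 1" using R' by simp
    finally have cR: "real (card (R' - {p} \<union> N)) \<le> real (card R) - 1 + real (card N)"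
      using card_R by linarith
    have "real (card N) = (\<Sum>j\<in>N. 1)" by simp
    also have "\<dots> \<le> (\<Sum>j\<in>N. (s p j)\<^sup>2)"
    proof (intro sum_mono)
      fix j assume j: "j \<in> N"
      hence "(s p j)\<^sup>2 \<in> \<int>" using sq p(1) unfolding N_def sym_square_integral_on_def by blast
      then obtain m :: int where m: "(s p j)\<^sup>2 = of_int m" by (auto elim: Ints_cases)
      have "(s p j)\<^sup>2 > 0" using j by (simp add: N_def)
      hence "m \<ge> 1" using m by simp
      thus "1 \<le> (s p j)\<^sup>2" using m by simp
    qed
    also have "\<dots> \<le> (\<Sum>j\<in>?W. (s p j)\<^sup>2)"
      using fin by (intro sum_mono2) (auto simp: N_def)
    finally have cN: "real (card N) \<le> (\<Sum>j\<in>?W. (s p j)\<^sup>2)" .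
    have "(\<Sum>i\<in>?W. schur_at p s i i) = (\<Sum>i\<in>?W. s i i) - (\<Sum>j\<in>?W. (s p j)\<^sup>2)"
      unfolding sum_subtractf[symmetric] using sym p
      by (intro sum.cong) (auto simp: schur_at_def power2_eq_square)
    moreover have "(\<Sum>i\<in>V. s i i) = 1 + (\<Sum>i\<in>?W. s i i)"
      using sum.remove[OF fin p(1), of "\<lambda>i. s i i"] p by simp
    moreover have "real (card ?W) = real (card V) - 1"
      using p fin Suc.hyps(2) by simp
    ultimately show ?thesis using IH cR cN by linarith
  qed
qed

text \<open>
  The nonzero upper diagonal is a Hamiltonian path, so a single representative suffices.
\<close>

lemma trace_lower_bound_path:
  assumes "pos_def_on {..<n} s" "sym_square_integral_on {..<n} s" "rational_up_to_scaling_on {..<n} s"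
    and nz: "\<And>i. i + 1 < n \<Longrightarrow> s i (i + 1) \<noteq> 0" and n: "n \<ge> 1"
  shows "2 * real n - 1 \<le> (\<Sum>i<n. s i i)"
proof -
  have "U \<inter> {0} \<noteq> {}" if U: "decoupled_in {..<n} s U" "U \<noteq> {}" for U
  proof -
    obtain i where "i \<in> U" using U by blast
    hence "0 \<in> U"
    proof (induction i)
      case (Suc i)
      hence "Suc i < n" using U by (auto simp: decoupled_in_def)
      hence "i \<in> {..<n}" "Suc i \<in> {..<n}" by auto
      hence "s (Suc i) i = s i (Suc i)"
        using assms(2) unfolding sym_square_integral_on_def by blast
      hence "s (Suc i) i \<noteq> 0" using nz[of i] \<open>Suc i < n\<close> by simp
      hence "i \<in> U" using U(1) Suc.prems \<open>Suc i < n\<close>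
        by (force simp: decoupled_in_def)
      thus ?case by (rule Suc.IH)
    qed
    thus ?thesis by blast
  qed
  from trace_lower_bound[OF _ assms(1-3) _ this] n show ?thesis by auto
qed

lemma square_sum_lower_bound:
  assumes "pos_def_on {..<n} s" "sym_square_integral_on {..<n} s" "rational_up_to_scaling_on {..<n} s"
    and nz: "\<And>i. i + 1 < n \<Longrightarrow> s i (i + 1) \<noteq> 0" and n: "n \<ge> 1"
  shows "6 * real n - 6 \<le> (\<Sum>i<n. \<Sum>j<n. (s i j)\<^sup>2)"
proof -
  have sym: "s i j = s j i" if "i < n" "j < n" for i j
    using assms(2) that unfolding sym_square_integral_on_def by blast
  have diag: "4 * real n - 4 \<le> (\<Sum>i<n. (s i i)\<^sup>2)"
  proof -
    have "(\<Sum>i<n. 4 * s i i - 4) \<le> (\<Sum>i<n. (s i i)\<^sup>2)"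
    proof (rule sum_mono)
      fix i show "4 * s i i - 4 \<le> (s i i)\<^sup>2"
        using zero_le_power2[of "s i i - 2"] by (simp add: power2_eq_square algebra_simps)
    qed
    moreover have "(\<Sum>i<n. 4 * s i i - 4) = 4 * (\<Sum>i<n. s i i) - 4 * real n"
      by (simp add: sum_subtractf sum_distrib_left)
    ultimately show ?thesis using trace_lower_bound_path[OF assms] by simp
  qed
  have ge1: "1 \<le> (s i (Suc i))\<^sup>2" if "i < n - 1" for i
  proof -
    have "i \<in> {..<n}" "Suc i \<in> {..<n}" using that by auto
    hence "(s i (Suc i))\<^sup>2 \<in> \<int>"
      using assms(2) unfolding sym_square_integral_on_def by blast
    then obtain m :: int where m: "(s i (Suc i))\<^sup>2 = of_int m" by (auto elim: Ints_cases)
    have "(s i (Suc i))\<^sup>2 > 0" using nz[of i] that by simp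
    hence "m \<ge> 1" using m by simp
    thus ?thesis using m by simp
  qed
  let ?f = "\<lambda>(i, j). (s i j)\<^sup>2"
  let ?D = "(\<lambda>i. (i, i)) ` {..<n}" and ?U = "(\<lambda>i. (i, Suc i)) ` {..<n - 1}"
    and ?L = "(\<lambda>i. (Suc i, i)) ` {..<n - 1}"
  have "sum ?f (?D \<union> ?U \<union> ?L) = sum ?f ?D + sum ?f ?U + sum ?f ?L"
    by (subst sum.union_disjoint; (subst sum.union_disjoint)?) auto
  also have "\<dots> = (\<Sum>i<n. (s i i)\<^sup>2) + (\<Sum>i<n - 1. (s i (Suc i))\<^sup>2) + (\<Sum>i<n - 1. (s (Suc i) i)\<^sup>2)"
    by (simp add: sum.reindex inj_on_def)
  also have "(\<Sum>i<n - 1. (s (Suc i) i)\<^sup>2) = (\<Sum>i<n - 1. (s i (Suc i))\<^sup>2)"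
    by (intro sum.cong) (use sym in auto)
  also have "(\<Sum>i<n. (s i i)\<^sup>2) + (\<Sum>i<n - 1. (s i (Suc i))\<^sup>2) + (\<Sum>i<n - 1. (s i (Suc i))\<^sup>2)
      \<ge> (4 * real n - 4) + (\<Sum>i<n - 1. 1) + (\<Sum>i<n - 1. 1)"
    by (intro add_mono diag sum_mono) (use ge1 in auto)
  finally have "6 * real n - 6 \<le> sum ?f (?D \<union> ?U \<union> ?L)" using n by (simp add: of_nat_diff)
  also have "\<dots> \<le> sum ?f ({..<n} \<times> {..<n})"
    by (intro sum_mono2) auto
  finally show ?thesis by (simp add: sum.cartesian_product)
qed

section \<open>Traces of powers\<close>

lemma mult_mat_entry:
  assumes "A \<in> carrier_mat n n" "B \<in> carrier_mat n n" "i < n" "j < n"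
  shows "(A * B) $$ (i, j) = (\<Sum>k<n. A $$ (i, k) * B $$ (k, j))"
  using assms by (auto simp: scalar_prod_def atLeast0LessThan intro!: sum.cong)

definition mat_trace :: "'a::comm_monoid_add mat \<Rightarrow> 'a" where
  "mat_trace A = (\<Sum>i<dim_row A. A $$ (i, i))"

lemma mat_trace_mult:
  assumes "A \<in> carrier_mat n n" "B \<in> carrier_mat n n"
  shows "mat_trace (A * B) = (\<Sum>i<n. \<Sum>k<n. A $$ (i, k) * B $$ (k, i))"
  using assms mult_mat_entry[OF assms]
  by (auto simp: mat_trace_def simp del: index_mult_mat(1) intro!: sum.cong)

lemma mat_trace_mult_commute:
  fixes A B :: "'a::comm_semiring_0 mat"
  assumes "A \<in> carrier_mat n n" "B \<in> carrier_mat n n"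
  shows "mat_trace (A * B) = mat_trace (B * A)"
proof -
  have "mat_trace (A * B) = (\<Sum>i<n. \<Sum>k<n. A $$ (i, k) * B $$ (k, i))"
    by (rule mat_trace_mult[OF assms])
  also have "\<dots> = (\<Sum>k<n. \<Sum>i<n. B $$ (k, i) * A $$ (i, k))"
    by (subst sum.swap) (simp add: mult.commute)
  also have "\<dots> = mat_trace (B * A)"
    by (rule mat_trace_mult[OF assms(2,1), symmetric])
  finally show ?thesis .
qed

lemma mat_trace_similar_pow:
  fixes A B :: "'a::comm_ring_1 mat"
  assumes A: "A \<in> carrier_mat n n" and sim: "similar_mat A B"
  shows "mat_trace (A ^\<^sub>m k) = mat_trace (B ^\<^sub>m k)"
proof -
  obtain P Q where wit: "similar_mat_wit A B P Q" using sim unfolding similar_mat_def by blast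
  note w = similar_mat_witD2[OF A wit]
  have Bk: "B ^\<^sub>m k \<in> carrier_mat n n" using w by simp
  have "mat_trace (A ^\<^sub>m k) = mat_trace ((P * B ^\<^sub>m k) * Q)"
    using similar_mat_wit_pow_id[OF wit] by simp
  also have "\<dots> = mat_trace (Q * (P * B ^\<^sub>m k))"
    using w Bk by (intro mat_trace_mult_commute[of _ n]) auto
  also have "Q * (P * B ^\<^sub>m k) = (Q * P) * B ^\<^sub>m k"
    using w Bk by (intro assoc_mult_mat[symmetric]) auto
  also have "\<dots> = B ^\<^sub>m k" using w Bk by simp
  finally show ?thesis .
qed

text \<open>
  Used for a Schur triangulation, whose diagonal lists the eigenvalues with multiplicity.
\<close>

lemma upper_triangular_pow:
  fixes B :: "'a::comm_semiring_1 mat"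
  assumes B: "B \<in> carrier_mat n n" and ut: "upper_triangular B"
  shows "(\<forall>i<n. \<forall>j<i. (B ^\<^sub>m k) $$ (i, j) = 0) \<and> (\<forall>i<n. (B ^\<^sub>m k) $$ (i, i) = (B $$ (i, i)) ^ k)"
proof (induction k)
  case 0 thus ?case using B by auto
next
  case (Suc k)
  have Bk: "B ^\<^sub>m k \<in> carrier_mat n n" using B by simp
  have low: "B $$ (i, j) = 0" if "i < n" "j < i" for i j
    using ut B that by (auto simp: upper_triangular_def)
  have term0: "(B ^\<^sub>m k) $$ (i, l) * B $$ (l, j) = 0" if "i < n" "l < n" "l < i \<or> j < l" for i j l
    using that low Suc.IH by (metis mult_zero_left mult_zero_right)
  have "(B ^\<^sub>m Suc k) $$ (i, j) = 0" if "i < n" "j < i" for i j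
  proof -
    have "(\<Sum>l<n. (B ^\<^sub>m k) $$ (i, l) * B $$ (l, j)) = 0"
      by (intro sum.neutral ballI term0) (use that in auto)
    thus ?thesis using mult_mat_entry[OF Bk B, of i j] that by (simp del: index_mult_mat(1))
  qed
  moreover have "(B ^\<^sub>m Suc k) $$ (i, i) = (B $$ (i, i)) ^ Suc k" if "i < n" for i
  proof -
    have "(\<Sum>l<n. (B ^\<^sub>m k) $$ (i, l) * B $$ (l, i))
        = (\<Sum>l\<in>{i}. (B ^\<^sub>m k) $$ (i, l) * B $$ (l, i))"
      by (intro sum.mono_neutral_right ballI term0) (use that in auto)
    thus ?thesis using mult_mat_entry[OF Bk B, of i i] that Suc.IH
      by (simp add: mult.commute del: index_mult_mat(1))
  qed
  ultimately show ?case by blast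
qed

lemma Tr_eq_mat_trace:
  assumes A: "A \<in> carrier_mat n n"
  shows "Tr k A = complex_of_real (mat_trace (A ^\<^sub>m k))"
proof -
  let ?C = "complex_mat A"
  have C: "?C \<in> carrier_mat n n" using A by simp
  obtain es where es: "char_poly ?C = (\<Prod>a\<leftarrow>es. [:- a, 1:])"
    using char_poly_factorized[OF C] by blast
  obtain B P Q where "schur_decomposition ?C es = (B, P, Q)"
    by (metis surj_pair)
  from schur_decomposition[OF C es this]
  have wit: "similar_mat_wit ?C B P Q" and ut: "upper_triangular B" and d: "diag_mat B = es"
    by auto
  have B: "B \<in> carrier_mat n n" using similar_mat_witD2[OF C wit] by simp
  have "proots (\<Prod>a\<leftarrow>xs. [:- a, 1:]) = mset xs" for xs :: "complex list"
  proof (induction xs)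
    case (Cons a xs)
    have "(\<Prod>a\<leftarrow>xs. [:- a, 1:]) \<noteq> 0" by (auto simp: prod_list_zero_iff)
    hence "proots ([:- a, 1:] * (\<Prod>a\<leftarrow>xs. [:- a, 1:]))
        = proots [:- a, 1:] + proots (\<Prod>a\<leftarrow>xs. [:- a, 1:])"
      by (intro proots_mult) auto
    thus ?case using Cons by (simp del: mult_pCons_left)
  qed simp
  hence "Tr k A = (\<Sum>\<beta>\<leftarrow>es. \<beta> ^ k)"
    unfolding Tr_def es by (simp flip: sum_mset_sum_list)
  also have "\<dots> = (\<Sum>i<n. (B $$ (i, i)) ^ k)"
    using B unfolding d[symmetric] diag_mat_def
    by (simp add: sum_list_map_eq_sum_count o_def interv_sum_list_conv_sum_set_nat atLeast0LessThan)
  also have "\<dots> = mat_trace (B ^\<^sub>m k)"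
    using upper_triangular_pow[OF B ut, of k] B by (simp add: mat_trace_def)
  also have "\<dots> = mat_trace (?C ^\<^sub>m k)"
    using mat_trace_similar_pow[OF C, of B k] wit unfolding similar_mat_def by metis
  also have "?C ^\<^sub>m k = map_mat complex_of_real (A ^\<^sub>m k)"
    by (rule of_real_hom.mat_hom_pow[OF A, symmetric])
  also have "mat_trace \<dots> = complex_of_real (mat_trace (A ^\<^sub>m k))"
    using A by (simp add: mat_trace_def)
  finally show ?thesis .
qed

lemma pow_mat_mult_add:
  fixes A :: "'a::semiring_1 mat"
  assumes A: "A \<in> carrier_mat n n"
  shows "A ^\<^sub>m (i + j) = A ^\<^sub>m i * A ^\<^sub>m j"
proof (induction j)
  case (Suc j)
  have "A ^\<^sub>m (i + Suc j) = (A ^\<^sub>m i * A ^\<^sub>m j) * A" using Suc by simp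
  also have "\<dots> = A ^\<^sub>m i * (A ^\<^sub>m j * A)"
    using A by (intro assoc_mult_mat) auto
  finally show ?case by simp
qed (use A in simp)

lemma transpose_pow_mat:
  fixes A :: "'a::comm_semiring_1 mat"
  assumes A: "A \<in> carrier_mat n n" and sym: "transpose_mat A = A"
  shows "transpose_mat (A ^\<^sub>m k) = A ^\<^sub>m k"
proof (induction k)
  case (Suc k)
  have "transpose_mat (A ^\<^sub>m Suc k) = transpose_mat A * transpose_mat (A ^\<^sub>m k)"
    using A by (simp add: transpose_mult[of _ n n])
  also have "\<dots> = A ^\<^sub>m (1 + k)"
    using A unfolding sym Suc pow_mat_mult_add[OF A] by simp
  finally show ?case by simp
qed (use A in auto)

lemma mat_trace_square_symmetric:
  fixes M :: "real mat"
  assumes M: "M \<in> carrier_mat n n" and sym: "transpose_mat M = M"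
  shows "mat_trace (M * M) = (\<Sum>i<n. \<Sum>j<n. (M $$ (i, j))\<^sup>2)"
proof -
  have "M $$ (j, i) = M $$ (i, j)" if "i < n" "j < n" for i j
    using sym M that by (metis carrier_matD index_transpose_mat(1))
  thus ?thesis
    unfolding mat_trace_mult[OF M M] by (auto simp: power2_eq_square intro!: sum.cong)
qed

lemma mat_trace_square_ge:
  fixes M :: "real mat"
  assumes M: "M \<in> carrier_mat n n" and sym: "transpose_mat M = M" and n: "n \<ge> 1"
  shows "(mat_trace M / n)\<^sup>2 \<le> mat_trace (M * M) / n"
proof -
  have "(\<Sum>i<n. M $$ (i, i) * 1)\<^sup>2 \<le> (\<Sum>i<n. (M $$ (i, i))\<^sup>2) * (\<Sum>i<n. 1\<^sup>2)"
    by (rule Cauchy_Schwarz_ineq_sum)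
  hence "(mat_trace M)\<^sup>2 \<le> (\<Sum>i<n. (M $$ (i, i))\<^sup>2) * n"
    using M by (simp add: mat_trace_def)
  also have "(\<Sum>i<n. (M $$ (i, i))\<^sup>2) \<le> (\<Sum>i<n. \<Sum>j<n. (M $$ (i, j))\<^sup>2)"
    by (intro sum_mono member_le_sum) auto
  hence "(\<Sum>i<n. (M $$ (i, i))\<^sup>2) * n \<le> mat_trace (M * M) * n"
    unfolding mat_trace_square_symmetric[OF M sym] by (intro mult_right_mono) auto
  finally show ?thesis using n by (simp add: field_simps power2_eq_square)
qed

text \<open>
  Squaring the power costs one application of the Cauchy-Schwarz inequality; powers of a symmetric
  matrix are symmetric, so it can be iterated.
\<close>

lemma mean_trace_power_ge:
  fixes S :: "real mat"
  assumes S: "S \<in> carrier_mat n n" and sym: "transpose_mat S = S" and n: "n \<ge> 1"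
  shows "(mat_trace (S ^\<^sub>m 2) / n) ^ (2 ^ k) \<le> mat_trace (S ^\<^sub>m (2 ^ Suc k)) / n"
proof (induction k)
  case (Suc k)
  let ?M = "S ^\<^sub>m (2 ^ Suc k)"
  have sq: "S ^\<^sub>m (2 ^ Suc (Suc k)) = ?M * ?M"
    using pow_mat_mult_add[OF S, of "2 ^ Suc k" "2 ^ Suc k"] by (simp add: mult_2)
  have "S ^\<^sub>m 2 = S * S" using S by (simp add: numeral_2_eq_2)
  hence "0 \<le> mat_trace (S ^\<^sub>m 2)" using mat_trace_square_symmetric[OF S sym] by (simp add: sum_nonneg)
  hence "((mat_trace (S ^\<^sub>m 2) / n) ^ (2 ^ k))\<^sup>2 \<le> (mat_trace ?M / n)\<^sup>2"
    by (intro power_mono Suc.IH) auto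
  also have "\<dots> \<le> mat_trace (?M * ?M) / n"
    using S by (intro mat_trace_square_ge n transpose_pow_mat[OF S sym]) auto
  finally show ?case unfolding sq by (simp add: power_mult mult.commute flip: power_mult)
qed simp

section \<open>Conjugate eigenvalues and positive forms\<close>

text \<open>
  Every algebraic number has a minimal polynomial; so it is one of its own conjugates, and a totally
  positive number is itself positive.
\<close>

lemma irreducible_rat_poly_root_exists:
  fixes z :: complex and q :: "rat poly"
  assumes "q \<noteq> 0" "poly (map_poly of_rat q) z = 0"
  shows "\<exists>p :: rat poly. irreducible p \<and> poly (map_poly of_rat p) z = 0"
  using assms
proof (induction "degree q" arbitrary: q rule: less_induct)
  case less
  interpret h: map_poly_inj_idom_hom "of_rat :: rat \<Rightarrow> complex" ..
  have nu: "\<not> is_unit q"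
  proof
    assume "is_unit q"
    hence "degree q = 0" using less.prems(1) is_unit_iff_degree by blast
    then obtain c where "q = [:c:]" by (rule degree_eq_zeroE)
    thus False using less.prems by auto
  qed
  show ?case
  proof (cases "irreducible q")
    case False
    then obtain a b where ab: "q = a * b" "\<not> is_unit a" "\<not> is_unit b"
      using less.prems(1) nu unfolding irreducible_def by blast
    have nz: "a \<noteq> 0" "b \<noteq> 0" using ab less.prems by auto
    hence "degree a > 0" "degree b > 0" using ab by (auto simp: is_unit_iff_degree)
    hence "degree a < degree q" "degree b < degree q"
      using nz unfolding ab(1) by (auto simp: degree_mult_eq)
    moreover have "poly (map_poly of_rat a) z = 0 \<or> poly (map_poly of_rat b) z = 0"
      using less.prems(2) unfolding ab(1) h.hom_mult by simp
    ultimately show ?thesis using less.hyps nz by blast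
  qed (use less in blast)
qed

lemma totally_positive_imp_pos:
  assumes "totally_positive z"
  shows "z \<in> \<real>" "Re z > 0"
proof -
  have "algebraic z" using assms by (simp add: totally_positive_def)
  then obtain p where p: "\<forall>i. coeff p i \<in> \<rat>" "p \<noteq> 0" "poly p z = 0"
    unfolding algebraic_altdef by blast
  obtain q where q: "p = map_poly of_rat q" using p(1) by (metis ratpolyE)
  have "q \<noteq> 0" using p(2) q by auto
  hence "conjugate_over_Q z z"
    using irreducible_rat_poly_root_exists[of q z] p(3) q unfolding conjugate_over_Q_def by blast
  thus "z \<in> \<real>" "Re z > 0" using assms unfolding totally_positive_def by blast+
qed

text \<open>
  If \<open>p\<close> did not divide \<open>q\<close>, a Bezout identity \<open>a * p + b * q = 1\<close> would fail at \<open>z\<close>.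
\<close>

lemma rat_poly_root_conjugate:
  fixes p q :: "rat poly" and z w :: complex
  assumes p: "irreducible p" and z: "poly (map_poly of_rat p) z = 0" "poly (map_poly of_rat q) z = 0"
    and w: "poly (map_poly of_rat p) w = 0"
  shows "poly (map_poly of_rat q) w = 0"
proof (cases "p dvd q")
  case True
  interpret h: map_poly_inj_idom_hom "of_rat :: rat \<Rightarrow> complex" ..
  show ?thesis using True w by (auto elim!: dvdE simp: h.hom_mult)
next
  case False
  interpret h: map_poly_inj_idom_hom "of_rat :: rat \<Rightarrow> complex" ..
  have "coprime p q"
    by (rule Factorial_Ring.prime_elem_imp_coprime[OF irreducible_imp_prime_elem_gcd[OF p] False])
  then obtain a b where "a * p + b * q = 1"
    by (metis bezout_coefficients_fst_snd coprime_imp_gcd_eq_1)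
  hence "map_poly (of_rat :: rat \<Rightarrow> complex) (a * p + b * q) = 1" by simp
  hence "poly (map_poly of_rat a * map_poly of_rat p + map_poly of_rat b * map_poly of_rat q) z = 1"
    by (simp add: h.hom_add h.hom_mult)
  thus ?thesis using z by simp
qed

text \<open>
  A symmetric form whose real eigenvalues are all positive is positive definite: by compactness it
  attains its minimum \<open>m\<close> on the unit sphere, a minimum point is an eigenvector for \<open>m\<close>, and the form is
  bounded below by \<open>m\<close> times the squared norm.
\<close>

lemma pos_def_on_real_eigen:
  fixes s :: "nat \<Rightarrow> nat \<Rightarrow> real"
  assumes sym: "\<And>i j. i < n \<Longrightarrow> j < n \<Longrightarrow> s i j = s j i"
    and ev: "\<And>m x. (\<exists>i<n. x i \<noteq> 0) \<Longrightarrow> (\<And>i. i < n \<Longrightarrow> (\<Sum>j<n. s i j * x j) = m * x i) \<Longrightarrow> m > 0"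
  shows "pos_def_on {..<n} s"
proof (cases "n = 0")
  case True thus ?thesis by (simp add: pos_def_on_def)
next
  case False
  define q where "q x = (\<Sum>i<n. \<Sum>j<n. s i j * x i * x j)" for x
  define nn where "nn x = (\<Sum>i<n. (x i)\<^sup>2)" for x :: "nat \<Rightarrow> real"
  define box :: "(nat \<Rightarrow> real) set" where "box = (\<Pi>\<^sub>E i\<in>UNIV. if i < n then {-1..1} else {0})"
  define K where "K = {x \<in> box. nn x = 1}"
  have coord: "continuous_on UNIV (\<lambda>x::nat \<Rightarrow> real. x i)" for i
    by (rule continuous_on_product_coordinates)
  have cq: "continuous_on UNIV q" and cn: "continuous_on UNIV nn"
    unfolding q_def[abs_def] nn_def[abs_def] by (intro continuous_intros coord)+
  have "compactin (product_topology (\<lambda>_. euclidean) UNIV) box"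
    unfolding box_def compactin_PiE by auto
  hence "compact box" by (simp add: euclidean_product_topology)
  moreover have "closed (nn -` {1})"
    using cn by (intro closed_vimage) (auto simp: continuous_on_eq_continuous_at)
  ultimately have "compact (box \<inter> nn -` {1})" by (rule compact_Int_closed)
  moreover have "box \<inter> nn -` {1} = K" by (auto simp: K_def)
  ultimately have cK: "compact K" by simp
  have "(\<lambda>i. if i = 0 then 1 else 0) \<in> K"
    using False by (auto simp: K_def box_def nn_def if_distrib power2_eq_square cong: if_cong)
  hence "K \<noteq> {}" by auto
  then obtain x0 where x0: "x0 \<in> K" "\<And>y. y \<in> K \<Longrightarrow> q x0 \<le> q y"
    using continuous_attains_inf[OF cK _ continuous_on_subset[OF cq]] by auto
  define m where "m = q x0"
  have nn1: "nn x0 = 1" using x0 by (simp add: K_def)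
  have bound: "m * nn x \<le> q x" for x
  proof (cases "nn x = 0")
    case True
    hence "x i = 0" if "i < n" for i
      using that by (auto simp: nn_def sum_nonneg_eq_0_iff)
    thus ?thesis using True by (simp add: q_def)
  next
    case nz: False
    hence pos: "nn x > 0" by (simp add: nn_def sum_nonneg order_less_le)
    define r where "r = sqrt (nn x)"
    have r: "r > 0" "r\<^sup>2 = nn x" using pos by (auto simp: r_def)
    define y where "y i = (if i < n then x i / r else 0)" for i
    have nny: "nn y = 1"
      using r pos by (simp add: nn_def y_def power_divide flip: sum_divide_distrib)
    have "\<bar>y i\<bar> \<le> 1" if "i < n" for i
    proof -
      have "(y i)\<^sup>2 \<le> nn y" unfolding nn_def using that by (intro member_le_sum) auto
      thus ?thesis using nny by (simp add: abs_square_le_1)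
    qed
    moreover have "y i = 0" if "\<not> i < n" for i using that by (simp add: y_def)
    ultimately have "y \<in> box" by (auto simp: box_def abs_le_iff minus_le_iff)
    hence "m \<le> q y" using x0(2) nny by (simp add: K_def m_def)
    also have "q y = q x / nn x"
      by (simp add: q_def y_def power2_eq_square sum_divide_distrib flip: r(2))
    finally show ?thesis using pos by (simp add: field_simps)
  qed
  have eig: "(\<Sum>j<n. s i j * x0 j) = m * x0 i" if i: "i < n" for i
  proof -
    define c where "c = (\<Sum>j<n. s i j * x0 j) - m * x0 i"
    define a where "a = s i i - m"
    \<comment> \<open>The form minus \<open>m\<close> times the squared norm, moved from its zero \<open>x0\<close> by \<open>t\<close> along the \<open>i\<close>-th axis;
      since it never becomes negative, its linear coefficient \<open>c\<close> must vanish.\<close>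
    have var: "0 \<le> 2 * t * c + t\<^sup>2 * a" for t
    proof -
      define e where "e j = (if j = i then t else 0)" for j
      let ?y = "\<lambda>j. x0 j + e j"
      have e_sum: "(\<Sum>j<n. f j * e j) = f i * t" for f
        using i by (simp add: e_def if_distrib cong: if_cong)
      have "q ?y = (\<Sum>k<n. (\<Sum>j<n. s k j * x0 k * x0 j) + (\<Sum>j<n. s k j * x0 k * e j)
          + (\<Sum>j<n. s k j * x0 j * e k) + (\<Sum>j<n. s k j * e k * e j))"
        unfolding q_def by (simp add: algebra_simps sum.distrib)
      also have "\<dots> = q x0 + (\<Sum>k<n. \<Sum>j<n. s k j * x0 k * e j)
          + (\<Sum>k<n. \<Sum>j<n. s k j * x0 j * e k) + (\<Sum>k<n. \<Sum>j<n. s k j * e k * e j)"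
        by (simp add: q_def sum.distrib)
      also have "(\<Sum>k<n. \<Sum>j<n. s k j * x0 k * e j) = (\<Sum>j<n. s i j * x0 j) * t"
        unfolding e_sum sum_distrib_right using sym i by (intro sum.cong) auto
      also have "(\<Sum>k<n. \<Sum>j<n. s k j * x0 j * e k) = (\<Sum>j<n. s i j * x0 j) * t"
        unfolding sum_distrib_right[symmetric] e_sum ..
      also have "(\<Sum>k<n. \<Sum>j<n. s k j * e k * e j) = s i i * t * t"
        unfolding e_sum using e_sum[of "\<lambda>k. s k i * t"] by (simp add: mult_ac)
      finally have qy: "q ?y = m + 2 * t * (\<Sum>j<n. s i j * x0 j) + t\<^sup>2 * s i i"
        by (simp add: m_def power2_eq_square algebra_simps)
      have "nn ?y = (\<Sum>k<n. (x0 k)\<^sup>2 + (2 * x0 k + e k) * e k)"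
        unfolding nn_def by (simp add: power2_eq_square algebra_simps)
      also have "\<dots> = nn x0 + (\<Sum>k<n. (2 * x0 k + e k) * e k)"
        by (simp add: sum.distrib nn_def)
      also have "\<dots> = 1 + (2 * x0 i + t) * t"
        unfolding e_sum nn1 by (simp add: e_def)
      finally have ny: "nn ?y = 1 + 2 * t * x0 i + t\<^sup>2"
        by (simp add: power2_eq_square algebra_simps)
      show ?thesis using bound[of ?y] unfolding qy ny c_def a_def by (simp add: algebra_simps)
    qed
    have "c = 0"
    proof (rule ccontr)
      assume c: "c \<noteq> 0"
      define B where "B = \<bar>a\<bar> + 1"
      have B: "B > 0" "a < B" by (auto simp: B_def)
      \<comment> \<open>A step \<open>t\<close> against \<open>c\<close>, short enough for the linear term to dominate.\<close>
      have "0 \<le> 2 * (- c / B) * c + (- c / B)\<^sup>2 * a" by (rule var)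
      also have "\<dots> \<le> 2 * (- c / B) * c + (- c / B)\<^sup>2 * B"
        using B by (intro add_left_mono mult_left_mono) auto
      also have "\<dots> = - (c\<^sup>2 / B)" using B by (simp add: power2_eq_square field_simps)
      also have "\<dots> < 0" using B c by simp
      finally show False by simp
    qed
    thus ?thesis by (simp add: c_def)
  qed
  have "\<exists>i<n. x0 i \<noteq> 0"
  proof (rule ccontr)
    assume "\<not> ?thesis"
    hence "nn x0 = 0" by (simp add: nn_def)
    thus False using nn1 by simp
  qed
  hence m: "m > 0" using ev[of x0 m] eig by blast
  show ?thesis unfolding pos_def_on_def
  proof (intro allI impI)
    fix x :: "nat \<Rightarrow> real" assume "\<exists>i\<in>{..<n}. x i \<noteq> 0"
    hence "nn x > 0" unfolding nn_def by (auto intro!: sum_pos2)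
    hence "0 < m * nn x" using m by simp
    also have "\<dots> \<le> q x" by (rule bound)
    finally show "0 < (\<Sum>i<n. \<Sum>j<n. s i j * x i * x j)" by (simp add: q_def)
  qed
qed

text \<open>
  Pair the eigenvector equation with the conjugate of \<open>v\<close>: \<open>z\<close> times the squared norm is a Hermitian
  form, so it is real, and it is the sum of the forms at the real and imaginary parts of \<open>v\<close>.
\<close>

lemma eigen_of_pos_def_on:
  fixes s :: "nat \<Rightarrow> nat \<Rightarrow> real" and v :: "nat \<Rightarrow> complex"
  assumes sym: "\<And>i j. i < n \<Longrightarrow> j < n \<Longrightarrow> s i j = s j i" and pd: "pos_def_on {..<n} s"
    and v: "\<exists>i<n. v i \<noteq> 0" and eq: "\<And>i. i < n \<Longrightarrow> (\<Sum>j<n. of_real (s i j) * v j) = z * v i"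
  shows "z \<in> \<real>" "Re z > 0"
proof -
  define N where "N = (\<Sum>i<n. (cmod (v i))\<^sup>2)"
  have N: "N > 0" unfolding N_def using v by (auto intro!: sum_pos2)
  define q where "q x = (\<Sum>i<n. \<Sum>j<n. s i j * x i * x j)" for x
  have norm_sq: "of_real (cmod w) ^ 2 = cnj w * w" for w :: complex
    by (metis complex_norm_square mult.commute of_real_power)
  have "(\<Sum>i<n. \<Sum>j<n. cnj (v i) * (of_real (s i j) * v j)) = (\<Sum>i<n. cnj (v i) * (z * v i))"
    using eq by (simp flip: sum_distrib_left)
  also have "\<dots> = z * of_real N"
    unfolding N_def of_real_sum sum_distrib_left of_real_power
    by (intro sum.cong refl) (simp only: norm_sq mult_ac)
  finally have form: "z * of_real N = (\<Sum>i<n. \<Sum>j<n. cnj (v i) * (of_real (s i j) * v j))" ..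
  have "cnj (z * of_real N) = (\<Sum>i<n. \<Sum>j<n. v i * (of_real (s i j) * cnj (v j)))"
    unfolding form by simp
  also have "\<dots> = (\<Sum>j<n. \<Sum>i<n. v i * (of_real (s i j) * cnj (v j)))"
    by (rule sum.swap)
  also have "\<dots> = z * of_real N"
    unfolding form using sym by (intro sum.cong) (auto simp: mult_ac)
  finally have "cnj z = z" using N by simp
  thus z: "z \<in> \<real>" by (metis Reals_cnj_iff)
  have "Re z * N = (\<Sum>i<n. \<Sum>j<n. s i j * (Re (v i) * Re (v j) + Im (v i) * Im (v j)))"
    using arg_cong[OF form, of Re] by (simp add: algebra_simps)
  also have "\<dots> = q (\<lambda>i. Re (v i)) + q (\<lambda>i. Im (v i))"
    by (simp add: q_def algebra_simps sum.distrib)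
  also have "\<dots> > 0"
  proof -
    have nonneg: "q x \<ge> 0" and pos: "(\<exists>i<n. x i \<noteq> 0) \<Longrightarrow> q x > 0" for x
    proof -
      show "(\<exists>i<n. x i \<noteq> 0) \<Longrightarrow> q x > 0"
        unfolding q_def using pd unfolding pos_def_on_def by blast
      thus "q x \<ge> 0"
        by (cases "\<exists>i<n. x i \<noteq> 0") (auto simp: q_def)
    qed
    obtain i where "i < n" "Re (v i) \<noteq> 0 \<or> Im (v i) \<noteq> 0" using v by (auto simp: complex_eq_iff)
    hence "q (\<lambda>i. Re (v i)) > 0 \<or> q (\<lambda>i. Im (v i)) > 0" by (metis (mono_tags) pos)
    thus ?thesis using nonneg[of "\<lambda>i. Re (v i)"] nonneg[of "\<lambda>i. Im (v i)"] by linarith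
  qed
  finally show "Re z > 0" using N by (simp add: zero_less_mult_iff)
qed

lemma pos_def_on_of_positive_definite:
  assumes A: "A \<in> carrier_mat n n" and S: "S \<in> carrier_mat n n" and sym: "transpose_mat S = S"
    and sim: "similar_mat A S" and pd: "positive_definite A"
  shows "pos_def_on {..<n} (\<lambda>i j. S $$ (i, j))"
proof (rule pos_def_on_real_eigen)
  show "S $$ (i, j) = S $$ (j, i)" if "i < n" "j < n" for i j
    using sym S that by (metis carrier_matD index_transpose_mat(1))
  fix m and x :: "nat \<Rightarrow> real"
  assume nz: "\<exists>i<n. x i \<noteq> 0" and eq: "\<And>i. i < n \<Longrightarrow> (\<Sum>j<n. S $$ (i, j) * x j) = m * x i"
  have "eigenvector S (vec n x) m"
    unfolding eigenvector_def
  proof (intro conjI)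
    show "vec n x \<noteq> 0\<^sub>v (dim_row S)"
    proof
      assume "vec n x = 0\<^sub>v (dim_row S)"
      moreover obtain i where i: "i < n" "x i \<noteq> 0" using nz by blast
      ultimately have "vec n x $ i = 0" using S by simp
      thus False using i by simp
    qed
    show "S *\<^sub>v vec n x = m \<cdot>\<^sub>v vec n x"
      using S eq by (intro eq_vecI) (auto simp: scalar_prod_def atLeast0LessThan)
  qed (use S in auto)
  hence "poly (char_poly S) m = 0"
    using eigenvalue_root_char_poly[OF S] by (auto simp: eigenvalue_def)
  hence "poly (char_poly A) m = 0" using char_poly_similar[OF sim] by simp
  hence "poly (char_poly (complex_mat A)) (complex_of_real m) = 0"
    using of_real_hom.char_poly_hom[OF A, where 'a = complex] by simp
  hence "eigenvalue (complex_mat A) (complex_of_real m)"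
    using eigenvalue_root_char_poly[of "complex_mat A" n] A by simp
  hence "totally_positive (complex_of_real m)"
    using pd by (simp add: positive_definite_def)
  from totally_positive_imp_pos(2)[OF this] show "m > 0" by simp
qed

lemma of_real_of_rat: "complex_of_real (real_of_rat q) = of_rat q"
proof -
  obtain a b where "q = of_int a / of_int b" by (cases q) (auto simp: Fract_of_int_quotient)
  thus ?thesis by (simp add: of_rat_divide)
qed

text \<open>
  The characteristic polynomial has rational coefficients, so every conjugate of an eigenvalue is an
  eigenvalue; and all eigenvalues are positive since the form is positive definite.
\<close>

lemma positive_definite_of_pos_def_on:
  assumes A: "A \<in> carrier_mat n n" and sym: "\<And>i j. i < n \<Longrightarrow> j < n \<Longrightarrow> A $$ (i, j) = A $$ (j, i)"
    and B: "B \<in> carrier_mat n n" and rat: "A = map_mat real_of_rat B"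
    and pd: "pos_def_on {..<n} (\<lambda>i j. A $$ (i, j))"
  shows "positive_definite A"
  unfolding positive_definite_def
proof (intro allI impI)
  have C: "complex_mat A \<in> carrier_mat n n" using A by simp
  have "complex_mat A = map_mat of_rat B" unfolding rat by (intro eq_matI) (auto simp: of_real_of_rat)
  hence cp: "char_poly (complex_mat A) = map_poly of_rat (char_poly B)"
    using of_rat_hom.char_poly_hom[OF B, where 'a = complex] by simp
  have pos: "z \<in> \<real> \<and> Re z > 0" if "poly (char_poly (complex_mat A)) z = 0" for z
  proof -
    obtain v where "eigenvector (complex_mat A) v z"
      using eigenvalue_root_char_poly[OF C] \<open>poly _ z = 0\<close> by (auto simp: eigenvalue_def)
    hence v: "v \<in> carrier_vec n" "v \<noteq> 0\<^sub>v n" "complex_mat A *\<^sub>v v = z \<cdot>\<^sub>v v"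
      using A by (auto simp: eigenvector_def)
    have "\<exists>i<n. v $ i \<noteq> 0" using v(1,2) by auto
    moreover have "(\<Sum>j<n. of_real (A $$ (i, j)) * v $ j) = z * v $ i" if "i < n" for i
    proof -
      have "(complex_mat A *\<^sub>v v) $ i = (\<Sum>j<n. of_real (A $$ (i, j)) * v $ j)"
        using that A v(1) by (auto simp: scalar_prod_def atLeast0LessThan intro!: sum.cong)
      thus ?thesis using v(1) that unfolding v(3) by simp
    qed
    ultimately show ?thesis
      using eigen_of_pos_def_on[OF sym pd, of "\<lambda>i. v $ i" z] by blast
  qed
  fix \<beta> assume "eigenvalue (complex_mat A) \<beta>"
  hence root: "poly (char_poly (complex_mat A)) \<beta> = 0"
    using eigenvalue_root_char_poly[OF C] by simp
  have nz: "char_poly (complex_mat A) \<noteq> 0" using degree_monic_char_poly[OF C] by auto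
  have "algebraic \<beta>" unfolding algebraic_altdef
    using root nz unfolding cp by (intro exI[of _ "map_poly of_rat (char_poly B)"]) auto
  moreover have "w \<in> \<real> \<and> Re w > 0" if "conjugate_over_Q \<beta> w" for w
  proof -
    obtain p :: "rat poly" where "irreducible p" "poly (map_poly of_rat p) \<beta> = 0"
      "poly (map_poly of_rat p) w = 0" using \<open>conjugate_over_Q \<beta> w\<close> by (auto simp: conjugate_over_Q_def)
    hence "poly (char_poly (complex_mat A)) w = 0"
      using rat_poly_root_conjugate root unfolding cp by blast
    thus ?thesis by (rule pos)
  qed
  ultimately show "totally_positive \<beta>" by (simp add: totally_positive_def)
qed


section \<open>Symmetric representatives\<close>

text \<open>
  Conjugation with the symmetrizing diagonal matrix leaves the products \<open>A $$ (i, j) * A $$ (j, i)\<close>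
  unchanged, and these are the squares of the entries of \<open>S\<close>. The scaling that makes \<open>S\<close> rational is the
  one that leads back to \<open>A\<close>.
\<close>

lemma S_n_symmetric_representative:
  assumes "A \<in> S_n n"
  obtains S where "S \<in> carrier_mat n n" "transpose_mat S = S" "similar_mat A S"
    "sym_square_integral_on {..<n} (\<lambda>i j. S $$ (i, j))"
    "rational_up_to_scaling_on {..<n} (\<lambda>i j. S $$ (i, j))"
    "\<And>i. i + 1 < n \<Longrightarrow> S $$ (i, i + 1) \<noteq> 0"
proof -
  have A: "A \<in> carrier_mat n n" and int: "\<And>i j. i < n \<Longrightarrow> j < n \<Longrightarrow> A $$ (i, j) \<in> \<int>"
    and up: "\<And>i. i + 1 < n \<Longrightarrow> A $$ (i, i + 1) \<noteq> 0" and "symmetrizable A"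
    using assms by (auto simp: S_n_def nonzero_upper_diagonal_def)
  then obtain m D D' where "A \<in> carrier_mat m m" "D \<in> carrier_mat m m" "D' \<in> carrier_mat m m"
    and diag: "diagonal_mat D" and pos: "\<forall>i<m. D $$ (i, i) > 0"
    and inv: "inverts_mat D D'" "inverts_mat D' D"
    and sym: "transpose_mat (D' * A * D) = D' * A * D"
    unfolding symmetrizable_def by blast
  with A have D: "D \<in> carrier_mat n n" "D' \<in> carrier_mat n n" and mn: "m = n" by auto
  have DD': "D * D' = 1\<^sub>m n" "D' * D = 1\<^sub>m n" using inv D by (auto simp: inverts_mat_def)
  define S where "S = D' * A * D"
  have S: "S \<in> carrier_mat n n" using A D by (simp add: S_def)
  have AD: "D * S = A * D"
  proof -
    have "D * S = D * (D' * (A * D))"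
      unfolding S_def using A D by (simp add: assoc_mult_mat[of _ n n _ n _ n])
    also have "\<dots> = (D * D') * (A * D)"
      using A D by (intro assoc_mult_mat[symmetric, of _ n n _ n _ n]) auto
    finally show ?thesis using A D DD' by simp
  qed
  have off: "D $$ (i, j) = 0" if "i < n" "j < n" "i \<noteq> j" for i j
    using diag D that by (auto simp: diagonal_mat_def)
  have entry: "D $$ (i, i) * S $$ (i, j) = A $$ (i, j) * D $$ (j, j)" if ij: "i < n" "j < n" for i j
  proof -
    have "(D * S) $$ (i, j) = (\<Sum>k\<in>{i}. D $$ (i, k) * S $$ (k, j))"
      unfolding mult_mat_entry[OF D(1) S ij]
      by (intro sum.mono_neutral_right) (use off ij in auto)
    moreover have "(A * D) $$ (i, j) = (\<Sum>k\<in>{j}. A $$ (i, k) * D $$ (k, j))"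
      unfolding mult_mat_entry[OF A D(1) ij]
      by (intro sum.mono_neutral_right) (use off ij in auto)
    ultimately show ?thesis unfolding AD by simp
  qed
  have Dpos: "D $$ (i, i) > 0" if "i < n" for i using pos mn that by simp
  have S_sym: "S $$ (j, i) = S $$ (i, j)" if "i < n" "j < n" for i j
    using sym S that unfolding S_def[symmetric] by (metis carrier_matD index_transpose_mat(1))
  show ?thesis
  proof (rule that[OF S])
    show "transpose_mat S = S" using sym by (simp add: S_def)
    have "similar_mat_wit S A D' D"
      using A D S DD' by (intro similar_mat_witI) (auto simp: S_def)
    thus "similar_mat A S" using similar_mat_sym unfolding similar_mat_def by blast
    show "sym_square_integral_on {..<n} (\<lambda>i j. S $$ (i, j))"
      unfolding sym_square_integral_on_def
    proof (intro ballI conjI)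
      fix i j assume ij: "i \<in> {..<n}" "j \<in> {..<n}"
      show "S $$ (i, j) = S $$ (j, i)" using S_sym ij by auto
      have "(D $$ (i, i) * D $$ (j, j)) * (S $$ (i, j))\<^sup>2
          = (D $$ (i, i) * S $$ (i, j)) * (D $$ (j, j) * S $$ (j, i))"
        unfolding S_sym[OF ij[unfolded lessThan_iff]] by (simp add: power2_eq_square mult_ac)
      also have "\<dots> = (D $$ (i, i) * D $$ (j, j)) * (A $$ (i, j) * A $$ (j, i))"
        using entry ij by simp
      finally have "(S $$ (i, j))\<^sup>2 = A $$ (i, j) * A $$ (j, i)"
        using Dpos[of i] Dpos[of j] ij by simp
      thus "(S $$ (i, j))\<^sup>2 \<in> \<int>" using int ij by simp
    qed
    show "rational_up_to_scaling_on {..<n} (\<lambda>i j. S $$ (i, j))"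
      unfolding rational_up_to_scaling_on_def
    proof (intro exI[of _ "\<lambda>i. 1 / D $$ (i, i)"] ballI conjI)
      fix i j assume ij: "i \<in> {..<n}" "j \<in> {..<n}"
      have "S $$ (i, j) * (1 / D $$ (j, j)) / (1 / D $$ (i, i)) = A $$ (i, j)"
        using entry[of i j] Dpos[of i] Dpos[of j] ij by (simp add: field_simps)
      also have "\<dots> \<in> \<rat>" using int ij Ints_subset_Rats by blast
      finally show "S $$ (i, j) * (1 / D $$ (j, j)) / (1 / D $$ (i, i)) \<in> \<rat>" .
    qed (use Dpos in force)
    show "S $$ (i, i + 1) \<noteq> 0" if "i + 1 < n" for i
      using entry[of i "i + 1"] up[OF that] Dpos[of "i + 1"] that by auto
  qed
qed

text \<open>
  The cycle that climbs from \<open>i\<close> to \<open>j\<close> along the upper diagonal and returns in one step.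
\<close>

lemma rational_cycle_consecutive:
  assumes "rational_cycle_condition A" "dim_row A = n" "j < n" "i + 2 \<le> j"
  shows "(\<Prod>l<j - i. A $$ (i + l, Suc (i + l))) * A $$ (j, i) \<in> \<rat>"
proof -
  define m where "m = j - i"
  have j: "j = i + m" "m \<ge> 2" using assms by (auto simp: m_def)
  let ?c = "[i..<Suc j]"
  have len: "length ?c = Suc m" using j by simp
  have nth: "?c ! t = i + t" if "t \<le> m" for t using that j by (simp del: upt_Suc)
  have "set ?c \<subseteq> {..<dim_row A} \<and> 3 \<le> length ?c \<and> length ?c \<le> dim_row A"
    using assms j by auto
  hence "(\<Prod>t<length ?c. A $$ (?c ! t, ?c ! ((t + 1) mod length ?c))) \<in> \<rat>"
    using assms(1) unfolding rational_cycle_condition_def by blast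
  also have "(\<Prod>t<length ?c. A $$ (?c ! t, ?c ! ((t + 1) mod length ?c)))
      = (\<Prod>t<m. A $$ (i + t, Suc (i + t))) * A $$ (i + m, i)"
    unfolding len prod.lessThan_Suc by (intro arg_cong2[of _ _ _ _ "(*)"] prod.cong) (auto simp: nth simp del: upt_Suc)
  finally show ?thesis by (simp add: j(1))
qed

lemma T_n_square_integral:
  assumes "A \<in> T_n n"
  shows "sym_square_integral_on {..<n} (\<lambda>i j. A $$ (i, j))"
  unfolding sym_square_integral_on_def
proof (intro ballI conjI)
  fix i j assume ij: "i \<in> {..<n}" "j \<in> {..<n}"
  have A: "A \<in> carrier_mat n n" "transpose_mat A = A" using assms by (auto simp: T_n_def)
  show "A $$ (i, j) = A $$ (j, i)" using A ij by (metis carrier_matD index_transpose_mat(1) lessThan_iff)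
  have "A $$ (i, j) \<in> {sqrt (real a) | a :: nat. a \<ge> 1} \<union> {- sqrt (real a) | a :: nat. a \<ge> 1} \<union> {0}"
    using assms ij unfolding T_n_def by blast
  thus "(A $$ (i, j))\<^sup>2 \<in> \<int>" by auto
qed

text \<open>
  Scale by the products of the upper diagonal entries. Then an entry above the upper diagonal becomes
  the product along a cycle that climbs the upper diagonal and closes up with this entry. The bound
  \<open>n \<ge> 3\<close> is needed for the diagonal: the loop \<open>i, i, i\<close> makes the cube of an entry rational, while for
  \<open>n \<le> 2\<close> the cycle condition is vacuous.
\<close>

lemma T_n_rational_up_to_scaling:
  assumes T: "A \<in> T_n n" and n: "n \<ge> 3"
  shows "rational_up_to_scaling_on {..<n} (\<lambda>i j. A $$ (i, j))"
proof -
  have A: "A \<in> carrier_mat n n" and up: "\<And>i. i + 1 < n \<Longrightarrow> A $$ (i, i + 1) \<noteq> 0"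
    and cyc: "rational_cycle_condition A"
    using T by (auto simp: T_n_def nonzero_upper_diagonal_def)
  have sym: "A $$ (i, j) = A $$ (j, i)" and sq: "(A $$ (i, j))\<^sup>2 \<in> \<rat>" if "i < n" "j < n" for i j
    using T_n_square_integral[OF T] that Ints_subset_Rats unfolding sym_square_integral_on_def by blast+
  define d where "d i = (\<Prod>l<i. A $$ (l, Suc l))" for i
  have d_nz: "d i \<noteq> 0" if "i < n" for i using up that by (auto simp: d_def)
  have d_split: "d (i + m) = d i * (\<Prod>l<m. A $$ (i + l, Suc (i + l)))" for i m
    by (induction m) (simp_all add: d_def)
  have upper: "A $$ (i, j) * d j / d i \<in> \<rat>" if ij: "i < j" "j < n" for i j
  proof -
    let ?p = "\<Prod>l<j - i. A $$ (i + l, Suc (i + l))"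
    have "A $$ (i, j) * d j / d i = ?p * A $$ (j, i)"
    proof -
      have "d j = d i * ?p" using d_split[of i "j - i"] ij by simp
      moreover have "A $$ (i, j) = A $$ (j, i)" using ij by (intro sym) auto
      ultimately show ?thesis using d_nz[of i] ij by simp
    qed
    also have "\<dots> \<in> \<rat>"
    proof (cases "i + 2 \<le> j")
      case True
      show ?thesis by (rule rational_cycle_consecutive[OF cyc _ ij(2) True]) (use A in simp)
    next
      case False
      hence "j = Suc i" using ij by simp
      moreover have "A $$ (j, i) = A $$ (i, j)" using ij by (intro sym) auto
      ultimately show ?thesis using sq[of i j] ij by (simp add: power2_eq_square)
    qed
    finally show ?thesis .
  qed
  have "A $$ (i, j) * d j / d i \<in> \<rat>" if ij: "i < n" "j < n" for i j
  proof (cases i j rule: linorder_cases)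
    case less
    thus ?thesis using upper ij by simp
  next
    case equal
    let ?c = "replicate 3 i"
    have "set ?c \<subseteq> {..<dim_row A} \<and> 3 \<le> length ?c \<and> length ?c \<le> dim_row A"
      using A n ij by auto
    hence "(\<Prod>t<length ?c. A $$ (?c ! t, ?c ! ((t + 1) mod length ?c))) \<in> \<rat>"
      using cyc unfolding rational_cycle_condition_def by blast
    also have "(\<Prod>t<length ?c. A $$ (?c ! t, ?c ! ((t + 1) mod length ?c))) = (\<Prod>t<(3::nat). A $$ (i, i))"
      by (intro prod.cong) simp_all
    also have "\<dots> = (A $$ (i, i))\<^sup>2 * A $$ (i, i)" by (simp add: power2_eq_square power3_eq_cube)
    finally have cube: "(A $$ (i, i))\<^sup>2 * A $$ (i, i) \<in> \<rat>" .
    have "A $$ (i, i) \<in> \<rat>"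
    proof (cases "A $$ (i, i) = 0")
      case False
      hence "A $$ (i, i) = ((A $$ (i, i))\<^sup>2 * A $$ (i, i)) / (A $$ (i, i))\<^sup>2" by simp
      also have "\<dots> \<in> \<rat>" using cube sq ij by (intro Rats_divide) auto
      finally show ?thesis .
    qed simp
    thus ?thesis using equal d_nz ij by simp
  next
    case greater
    \<comment> \<open>The scaled entries at \<open>(i, j)\<close> and \<open>(j, i)\<close> multiply to the square of the entry.\<close>
    have "A $$ (i, j) * d j / d i = (A $$ (i, j))\<^sup>2 / (A $$ (j, i) * d i / d j)"
      unfolding sym[OF ij(2,1)] using d_nz[of i] d_nz[of j] ij
      by (cases "A $$ (i, j) = 0") (auto simp: field_simps power2_eq_square)
    also have "\<dots> \<in> \<rat>" using upper[OF greater ij(1)] sq[OF ij] by (rule Rats_divide[rotated])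
    finally show ?thesis .
  qed
  thus ?thesis unfolding rational_up_to_scaling_on_def using d_nz by (intro exI[of _ d]) auto
qed

lemma symmetric_representative:
  assumes "A \<in> S_n n \<union> T_n n"
  obtains S where "S \<in> carrier_mat n n" "transpose_mat S = S" "similar_mat A S"
    "sym_square_integral_on {..<n} (\<lambda>i j. S $$ (i, j))"
    "n \<ge> 3 \<Longrightarrow> 6 * real n - 6 \<le> mat_trace (S ^\<^sub>m 2)"
proof -
  obtain S where S: "S \<in> carrier_mat n n" "transpose_mat S = S" "similar_mat A S"
    "sym_square_integral_on {..<n} (\<lambda>i j. S $$ (i, j))"
    and scal: "n \<ge> 3 \<Longrightarrow> rational_up_to_scaling_on {..<n} (\<lambda>i j. S $$ (i, j))"
    and up: "\<And>i. i + 1 < n \<Longrightarrow> S $$ (i, i + 1) \<noteq> 0"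
  proof (cases "A \<in> S_n n")
    case True
    then obtain S where "S \<in> carrier_mat n n" "transpose_mat S = S" "similar_mat A S"
      "sym_square_integral_on {..<n} (\<lambda>i j. S $$ (i, j))"
      "rational_up_to_scaling_on {..<n} (\<lambda>i j. S $$ (i, j))"
      "\<And>i. i + 1 < n \<Longrightarrow> S $$ (i, i + 1) \<noteq> 0" by (rule S_n_symmetric_representative) blast
    thus ?thesis using that by blast
  next
    case False
    hence T: "A \<in> T_n n" using assms by blast
    hence "A \<in> carrier_mat n n" "transpose_mat A = A" "\<And>i. i + 1 < n \<Longrightarrow> A $$ (i, i + 1) \<noteq> 0"
      by (auto simp: T_n_def nonzero_upper_diagonal_def)
    thus ?thesis
      using that[of A] T_n_square_integral[OF T] T_n_rational_up_to_scaling[OF T] similar_mat_refl[of A n]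
      by blast
  qed
  have A: "A \<in> carrier_mat n n" "positive_definite A" using assms by (auto simp: S_n_def T_n_def)
  show ?thesis
  proof (rule that[OF S])
    assume n: "n \<ge> 3"
    have "6 * real n - 6 \<le> (\<Sum>i<n. \<Sum>j<n. (S $$ (i, j))\<^sup>2)"
      using n by (intro square_sum_lower_bound S(4) scal up
          pos_def_on_of_positive_definite[OF A(1) S(1,2,3) A(2)]) auto
    also have "\<dots> = mat_trace (S ^\<^sub>m 2)"
      using mat_trace_square_symmetric[OF S(1,2)] S(1) by (simp add: numeral_2_eq_2)
    finally show "6 * real n - 6 \<le> mat_trace (S ^\<^sub>m 2)" .
  qed
qed

lemma mean_Tr_eq:
  assumes "A \<in> carrier_mat n n" "similar_mat A S"
  shows "mean_Tr k A = complex_of_real (mat_trace (S ^\<^sub>m k) / n)"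
  using assms by (simp add: mean_Tr_def Tr_eq_mat_trace mat_trace_similar_pow)

lemma finite_bounded_square_integral_mats:
  "finite {S \<in> carrier_mat n n. \<forall>i<n. \<forall>j<n. (S $$ (i, j))\<^sup>2 \<in> \<int> \<and> (S $$ (i, j))\<^sup>2 \<le> (C :: real)}"
proof -
  let ?F = "(\<lambda>k. sqrt (of_int k)) ` {0..\<lfloor>C\<rfloor>} \<union> (\<lambda>k. - sqrt (of_int k)) ` {0..\<lfloor>C\<rfloor>}"
  have F: "x \<in> ?F" if x: "x\<^sup>2 \<in> \<int>" "x\<^sup>2 \<le> C" for x :: real
  proof -
    obtain k :: int where k: "x\<^sup>2 = of_int k" using x(1) by (auto elim: Ints_cases)
    have "k \<in> {0..\<lfloor>C\<rfloor>}" using k x(2) zero_le_power2[of x] by (auto simp: le_floor_iff)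
    moreover have "x = sqrt (of_int k) \<or> x = - sqrt (of_int k)"
      unfolding k[symmetric] by (auto simp: abs_if)
    ultimately show ?thesis by blast
  qed
  let ?E = "({..<n} \<times> {..<n}) \<rightarrow>\<^sub>E ?F"
  have "finite ?E" by (intro finite_PiE) auto
  moreover have "{S \<in> carrier_mat n n. \<forall>i<n. \<forall>j<n. (S $$ (i, j))\<^sup>2 \<in> \<int> \<and> (S $$ (i, j))\<^sup>2 \<le> C}
      \<subseteq> mat n n ` ?E"
  proof
    fix S assume S: "S \<in> {S \<in> carrier_mat n n. \<forall>i<n. \<forall>j<n. (S $$ (i, j))\<^sup>2 \<in> \<int> \<and> (S $$ (i, j))\<^sup>2 \<le> C}"
    let ?f = "restrict (\<lambda>p. S $$ p) ({..<n} \<times> {..<n})"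
    have "S = mat n n ?f" using S by (intro eq_matI) auto
    moreover have "?f \<in> ?E"
    proof (intro restrict_PiE_iff[THEN iffD2] ballI)
      fix q assume "q \<in> {..<n} \<times> {..<n}"
      then obtain i j where "q = (i, j)" "i < n" "j < n" by auto
      thus "S $$ q \<in> ?F" using S F[of "S $$ (i, j)"] by blast
    qed
    ultimately show "S \<in> mat n n ` ?E" by blast
  qed
  ultimately show ?thesis by (meson finite_imageI finite_subset)
qed

text \<open>
  A value at most \<open>x\<close> bounds the mean of the squares of the eigenvalues below \<open>6\<close> by a fixed margin. By
  the lower bound \<open>6 - 6 / n\<close> on that mean the size is bounded; then the entries are bounded as well.
\<close>

lemma finite_W_below:
  fixes x :: real
  assumes "x < 6 ^ (2 ^ m)"
  shows "finite (W (Suc m) \<inter> {..x})"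
proof -
  have "(\<lambda>n. (6 - 6 / real n) ^ (2 ^ m)) \<longlonglongrightarrow> (6 - 0) ^ (2 ^ m)"
    by (intro tendsto_intros lim_const_over_n)
  hence "eventually (\<lambda>n. x < (6 - 6 / real n) ^ (2 ^ m)) sequentially"
    using assms by (intro order_tendstoD) auto
  then obtain N where N: "\<And>n. n \<ge> N \<Longrightarrow> x < (6 - 6 / real n) ^ (2 ^ m)"
    unfolding eventually_sequentially by blast
  define M where "M = max N 3"
  define C where "C = real M * max 1 x"
  let ?B = "\<lambda>n. {S \<in> carrier_mat n n. \<forall>i<n. \<forall>j<n. (S $$ (i, j))\<^sup>2 \<in> \<int> \<and> (S $$ (i, j))\<^sup>2 \<le> C}"
  have "W (Suc m) \<inter> {..x} \<subseteq> (\<lambda>S. mat_trace (S ^\<^sub>m (2 ^ Suc m)) / dim_row S) ` (\<Union>n<M. ?B n)"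
  proof
    fix y assume "y \<in> W (Suc m) \<inter> {..x}"
    then obtain A where AA: "A \<in> S_all \<union> T_all" and yA: "complex_of_real y = mean_Tr (2 ^ Suc m) A"
      and yx: "y \<le> x" by (auto simp: W_def)
    then obtain n where n: "n \<ge> 1" and An: "A \<in> S_n n \<union> T_n n"
      by (auto simp: S_all_def T_all_def)
    hence A: "A \<in> carrier_mat n n" by (auto simp: S_n_def T_n_def)
    obtain S where S: "S \<in> carrier_mat n n" "transpose_mat S = S" "similar_mat A S"
      "sym_square_integral_on {..<n} (\<lambda>i j. S $$ (i, j))"
      and low: "n \<ge> 3 \<Longrightarrow> 6 * real n - 6 \<le> mat_trace (S ^\<^sub>m 2)"
      using symmetric_representative[OF An] by blast
    have y: "y = mat_trace (S ^\<^sub>m (2 ^ Suc m)) / n"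
      using yA unfolding mean_Tr_eq[OF A S(3)] of_real_eq_iff .
    let ?t = "mat_trace (S ^\<^sub>m 2) / n"
    have t: "?t ^ (2 ^ m) \<le> x"
      using mean_trace_power_ge[OF S(1,2) n, of m] yx unfolding y by linarith
    have "n < M"
    proof (rule ccontr)
      assume "\<not> n < M"
      hence nM: "n \<ge> N" "n \<ge> 3" by (auto simp: M_def)
      have "6 - 6 / real n = (6 * real n - 6) / n" using n by (simp add: field_simps)
      also have "\<dots> \<le> ?t" using low nM by (intro divide_right_mono) auto
      finally have "(6 - 6 / real n) ^ (2 ^ m) \<le> ?t ^ (2 ^ m)"
        using nM by (intro power_mono) (auto simp: field_simps)
      thus False using N[OF nM(1)] t by linarith
    qed
    have "?t \<le> max 1 x"
    proof (rule ccontr)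
      assume *: "\<not> ?t \<le> max 1 x"
      hence "?t \<le> ?t ^ (2 ^ m)" by (intro self_le_power) auto
      thus False using * t by linarith
    qed
    hence "mat_trace (S ^\<^sub>m 2) \<le> n * max 1 x" using n by (simp add: field_simps)
    also have "\<dots> \<le> C" unfolding C_def using \<open>n < M\<close> by (intro mult_right_mono) auto
    finally have trC: "(\<Sum>i<n. \<Sum>j<n. (S $$ (i, j))\<^sup>2) \<le> C"
      using mat_trace_square_symmetric[OF S(1,2)] S(1) by (simp add: numeral_2_eq_2)
    have "(S $$ (i, j))\<^sup>2 \<le> C" if "i < n" "j < n" for i j
    proof -
      have "(S $$ (i, j))\<^sup>2 \<le> (\<Sum>j<n. (S $$ (i, j))\<^sup>2)"
        using that by (intro member_le_sum) auto
      also have "\<dots> \<le> (\<Sum>i<n. \<Sum>j<n. (S $$ (i, j))\<^sup>2)"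
        using that by (intro member_le_sum[of i "{..<n}" "\<lambda>i. \<Sum>j<n. (S $$ (i, j))\<^sup>2"] sum_nonneg) auto
      finally show ?thesis using trC by linarith
    qed
    moreover have "(S $$ (i, j))\<^sup>2 \<in> \<int>" if "i < n" "j < n" for i j
      using S(4) that unfolding sym_square_integral_on_def by blast
    ultimately have "S \<in> ?B n" using S(1) by blast
    moreover have "y = mat_trace (S ^\<^sub>m (2 ^ Suc m)) / dim_row S" using y S(1) by simp
    ultimately show "y \<in> (\<lambda>S. mat_trace (S ^\<^sub>m (2 ^ Suc m)) / dim_row S) ` (\<Union>n<M. ?B n)"
      using \<open>n < M\<close> by blast
  qed
  moreover have "finite (\<Union>n<M. ?B n)" using finite_bounded_square_integral_mats by blast
  ultimately show ?thesis by (meson finite_imageI finite_subset)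
qed

lemma W_limit_point_ge:
  assumes "x islimpt W (Suc m)"
  shows "6 ^ (2 ^ m) \<le> x"
proof (rule ccontr)
  assume "\<not> ?thesis"
  then obtain y where y: "x < y" "y < 6 ^ (2 ^ m)" using dense[of x "6 ^ (2 ^ m)"] by auto
  have "infinite (W (Suc m) \<inter> ball x (y - x))"
    using assms y(1) by (simp add: islimpt_eq_infinite_ball)
  moreover have "W (Suc m) \<inter> ball x (y - x) \<subseteq> W (Suc m) \<inter> {..y}"
    by (auto simp: dist_real_def)
  ultimately show False using finite_W_below[OF y(2)] finite_subset by blast
qed

section \<open>Path matrices\<close>

text \<open>
  Generic in the ring, so that the same matrix can be read over the rationals and over the reals.
\<close>

definition path_mat :: "nat \<Rightarrow> 'a::comm_ring_1 mat" where
  "path_mat n = mat n n (\<lambda>(i, j). if i = j then 2 else if i = Suc j \<or> j = Suc i then 1 else 0)"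

lemma path_mat_carrier [simp]: "path_mat n \<in> carrier_mat n n"
  by (simp add: path_mat_def)

lemma path_mat_dim [simp]: "dim_row (path_mat n) = n" "dim_col (path_mat n) = n"
  by (simp_all add: path_mat_def)

lemma path_mat_entry:
  "i < n \<Longrightarrow> j < n \<Longrightarrow>
     path_mat n $$ (i, j) = (if i = j then 2 else if i = Suc j \<or> j = Suc i then 1 else 0)"
  by (simp add: path_mat_def)

lemma path_mat_quadratic_form:
  fixes x :: "nat \<Rightarrow> real"
  shows "(\<Sum>i<Suc n. \<Sum>j<Suc n. path_mat (Suc n) $$ (i, j) * x i * x j)
     = (x 0)\<^sup>2 + (\<Sum>i<n. (x i + x (Suc i))\<^sup>2) + (x n)\<^sup>2"
proof (induction n)
  case 0 thus ?case by (simp add: path_mat_entry power2_eq_square)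
next
  case (Suc n)
  have eq: "path_mat (Suc (Suc n)) $$ (i, j) = (path_mat (Suc n) $$ (i, j) :: real)"
    if "i < Suc n" "j < Suc n" for i j
    using that by (simp add: path_mat_entry)
  let ?m = "\<lambda>i j. path_mat (Suc (Suc n)) $$ (i, j) :: real"
  have last: "(\<Sum>j<Suc n. ?m j (Suc n) * x j * x (Suc n)) = x n * x (Suc n)"
    "(\<Sum>j<Suc n. ?m (Suc n) j * x (Suc n) * x j) = x n * x (Suc n)"
    by (subst sum.mono_neutral_right[of _ "{n}"]; simp add: path_mat_entry)+
  have "(\<Sum>i<Suc (Suc n). \<Sum>j<Suc (Suc n). ?m i j * x i * x j)
     = (\<Sum>i<Suc n. \<Sum>j<Suc n. ?m i j * x i * x j) + (\<Sum>j<Suc n. ?m j (Suc n) * x j * x (Suc n))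
       + (\<Sum>j<Suc n. ?m (Suc n) j * x (Suc n) * x j) + ?m (Suc n) (Suc n) * x (Suc n) * x (Suc n)"
    unfolding sum.lessThan_Suc[of _ "Suc n"] by (simp only: sum.distrib add.assoc)
  also have "(\<Sum>i<Suc n. \<Sum>j<Suc n. ?m i j * x i * x j)
      = (\<Sum>i<Suc n. \<Sum>j<Suc n. path_mat (Suc n) $$ (i, j) * x i * x j)"
    by (intro sum.cong refl) (simp add: eq)
  finally show ?case unfolding Suc.IH last
    by (simp add: path_mat_entry power2_eq_square algebra_simps)
qed

lemma path_mat_pos_def: "pos_def_on {..<n} (\<lambda>i j. (path_mat n :: real mat) $$ (i, j))"
proof (cases n)
  case (Suc m)
  show ?thesis unfolding pos_def_on_def Suc path_mat_quadratic_form
  proof (intro allI impI)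
    fix x :: "nat \<Rightarrow> real" assume nz: "\<exists>i\<in>{..<Suc m}. x i \<noteq> 0"
    let ?q = "(x 0)\<^sup>2 + (\<Sum>i<m. (x i + x (Suc i))\<^sup>2) + (x m)\<^sup>2"
    have S: "(\<Sum>i<m. (x i + x (Suc i))\<^sup>2) \<ge> 0" by (intro sum_nonneg) auto
    show "0 < ?q"
    proof (rule ccontr)
      assume "\<not> 0 < ?q"
      hence 0: "x 0 = 0" "(\<Sum>i<m. (x i + x (Suc i))\<^sup>2) = 0"
        using S zero_le_power2[of "x 0"] zero_le_power2[of "x m"]
        by (smt (verit) zero_less_power2)+
      have "x i = 0" if "i \<le> m" for i using that
      proof (induction i)
        case (Suc i)
        have "(x i + x (Suc i))\<^sup>2 = 0" using 0(2) Suc.prems by (simp add: sum_nonneg_eq_0_iff)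
        thus ?case using Suc by simp
      qed (use 0 in simp)
      thus False using nz by auto
    qed
  qed
qed (simp add: pos_def_on_def)

lemma path_mat_in_S_all:
  assumes "n \<ge> 1"
  shows "(path_mat n :: real mat) \<in> S_all"
proof -
  let ?P = "path_mat n :: real mat"
  have "positive_definite ?P"
  proof (rule positive_definite_of_pos_def_on[of _ n "path_mat n"])
    show "?P = map_mat real_of_rat (path_mat n)"
      by (intro eq_matI) (auto simp: path_mat_entry)
  qed (auto simp: path_mat_entry path_mat_pos_def)
  moreover have "symmetrizable ?P" unfolding symmetrizable_def
  proof (intro exI[of _ n] exI[of _ "1\<^sub>m n"] conjI)
    have "1\<^sub>m n * ?P * 1\<^sub>m n = ?P" by simp
    moreover have "transpose_mat ?P = ?P" by (intro eq_matI) (auto simp: path_mat_entry)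
    ultimately show "transpose_mat (1\<^sub>m n * ?P * 1\<^sub>m n) = 1\<^sub>m n * ?P * 1\<^sub>m n" by simp
  qed (auto simp: diagonal_mat_def inverts_mat_def)
  ultimately have "?P \<in> S_n n"
    unfolding S_n_def nonzero_upper_diagonal_def nonzero_lower_diagonal_def
    by (auto simp: path_mat_entry)
  thus ?thesis using assms by (auto simp: S_all_def)
qed

lemma path_mat_pow_nonneg:
  "i < n \<Longrightarrow> j < n \<Longrightarrow> 0 \<le> ((path_mat n :: real mat) ^\<^sub>m m) $$ (i, j)"
proof (induction m arbitrary: j)
  case (Suc m)
  show ?case unfolding pow_mat.simps mult_mat_entry[OF pow_carrier_mat[OF path_mat_carrier] path_mat_carrier Suc.prems]
    using Suc by (intro sum_nonneg mult_nonneg_nonneg) (auto simp: path_mat_entry)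
qed simp

lemma path_mat_pow_Suc_entry:
  assumes "i < n" "j < n"
  shows "((path_mat n :: real mat) ^\<^sub>m Suc m) $$ (i, j)
    = (\<Sum>k<n. ((path_mat n :: real mat) ^\<^sub>m m) $$ (i, k) * path_mat n $$ (k, j))"
  unfolding pow_mat.simps
  by (rule mult_mat_entry[OF pow_carrier_mat[OF path_mat_carrier] path_mat_carrier assms])

text \<open>
  Entries of powers count weighted walks, and walks in a segment of a path are walks in the path.
\<close>

lemma path_mat_pow_subpath:
  assumes "a + n \<le> N" "i < n" "j < n"
  shows "((path_mat n :: real mat) ^\<^sub>m m) $$ (i, j) \<le> ((path_mat N :: real mat) ^\<^sub>m m) $$ (a + i, a + j)"
  using assms(2,3)
proof (induction m arbitrary: j)
  case 0 thus ?case using assms(1) by simp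
next
  case (Suc m)
  let ?P = "path_mat n :: real mat" and ?Q = "path_mat N :: real mat"
  let ?f = "\<lambda>k. (?Q ^\<^sub>m m) $$ (a + i, k) * ?Q $$ (k, a + j)"
  have "(?P ^\<^sub>m Suc m) $$ (i, j) = (\<Sum>k<n. (?P ^\<^sub>m m) $$ (i, k) * ?P $$ (k, j))"
    by (rule path_mat_pow_Suc_entry[OF Suc.prems])
  also have "\<dots> \<le> (\<Sum>k<n. ?f (a + k))"
    using Suc assms(1) by (intro sum_mono mult_mono path_mat_pow_nonneg) (auto simp: path_mat_entry)
  also have "\<dots> = sum ?f ((+) a ` {..<n})" by (simp add: sum.reindex)
  also have "\<dots> \<le> sum ?f {..<N}"
    using Suc.prems assms(1)
    by (intro sum_mono2 mult_nonneg_nonneg path_mat_pow_nonneg) (auto simp: path_mat_entry)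
  also have "\<dots> = (?Q ^\<^sub>m Suc m) $$ (a + i, a + j)"
    using Suc.prems assms(1) by (intro path_mat_pow_Suc_entry[symmetric]) auto
  finally show ?case .
qed

lemma path_mat_pow_pos:
  assumes "Suc i < n" "m \<ge> 1"
  shows "0 < ((path_mat n :: real mat) ^\<^sub>m m) $$ (i, Suc i)"
proof -
  let ?P = "path_mat n :: real mat"
  have step: "(?P ^\<^sub>m m) $$ (i, i) * ?P $$ (i, j) \<le> (?P ^\<^sub>m Suc m) $$ (i, j)"
    if "j < n" for m j
    unfolding path_mat_pow_Suc_entry[OF Suc_lessD[OF assms(1)] that]
    using that assms(1)
    by (intro member_le_sum[of i "{..<n}" "\<lambda>k. (?P ^\<^sub>m m) $$ (i, k) * ?P $$ (k, j)"]
        mult_nonneg_nonneg path_mat_pow_nonneg) (auto simp: path_mat_entry)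
  have diag: "0 < (?P ^\<^sub>m m) $$ (i, i)" for m
  proof (induction m)
    case (Suc m)
    thus ?case using step[of i m] assms(1) by (simp add: path_mat_entry del: pow_mat.simps)
  qed (use assms(1) in simp)
  obtain l where "m = Suc l" using assms(2) by (cases m) auto
  thus ?thesis using step[of "Suc i" l] diag[of l] assms(1)
    by (simp add: path_mat_entry del: pow_mat.simps)
qed

text \<open>
  A path with \<open>n + p\<close> vertices contains disjoint paths with \<open>n\<close> and \<open>p\<close> vertices, joined by an edge. For
  \<open>m \<ge> 2\<close> some closed walk of length \<open>m\<close> uses that edge.
\<close>

lemma path_mat_trace_superadditive:
  assumes n: "n \<ge> 1" and m: "m \<ge> 2" and p: "p \<ge> 1"
  shows "mat_trace ((path_mat n :: real mat) ^\<^sub>m m) + mat_trace ((path_mat p :: real mat) ^\<^sub>m m)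
    < mat_trace ((path_mat (n + p) :: real mat) ^\<^sub>m m)"
proof -
  let ?P = "path_mat n :: real mat" and ?Q = "path_mat p :: real mat"
    and ?R = "path_mat (n + p) :: real mat"
  let ?r = "\<lambda>i. (?R ^\<^sub>m m) $$ (i, i)"
  obtain l where l: "m = Suc l" "l \<ge> 1" using m by (cases m) auto
  obtain e where e: "n = Suc e" using n by (cases n) auto
  \<comment> \<open>The strict gain comes from closed walks based at the last vertex of the first path that
    cross the edge joining the two paths.\<close>
  have strict: "(?P ^\<^sub>m m) $$ (e, e) < ?r e"
  proof -
    let ?f = "\<lambda>k. (?R ^\<^sub>m l) $$ (e, k) * ?R $$ (k, e)"
    have "(?P ^\<^sub>m m) $$ (e, e) = (\<Sum>k<n. (?P ^\<^sub>m l) $$ (e, k) * ?P $$ (k, e))"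
      unfolding l(1) using e by (intro path_mat_pow_Suc_entry) auto
    also have "\<dots> \<le> sum ?f {..<n}"
      using path_mat_pow_subpath[of 0 n "n + p" e _ l] e
      by (intro sum_mono mult_mono path_mat_pow_nonneg) (auto simp: path_mat_entry)
    also have "\<dots> < sum ?f {..<n} + ?f n"
      using path_mat_pow_pos[of e "n + p" l] e l(2) p by (simp add: path_mat_entry)
    also have "\<dots> = sum ?f {..<Suc n}" by simp
    also have "\<dots> \<le> sum ?f {..<n + p}"
      using e p by (intro sum_mono2 mult_nonneg_nonneg path_mat_pow_nonneg) (auto simp: path_mat_entry)
    also have "\<dots> = ?r e"
      unfolding l(1) using e by (intro path_mat_pow_Suc_entry[symmetric]) auto
    finally show ?thesis .
  qed
  have "mat_trace (?P ^\<^sub>m m) < (\<Sum>i<n. ?r i)"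
    unfolding mat_trace_def pow_mat_dim path_mat_dim
    using strict e path_mat_pow_subpath[of 0 n "n + p" _ _ m]
    by (intro sum_strict_mono_ex1) auto
  moreover have "mat_trace (?Q ^\<^sub>m m) \<le> (\<Sum>i<p. ?r (n + i))"
    unfolding mat_trace_def pow_mat_dim path_mat_dim
    using path_mat_pow_subpath[of n p "n + p" _ _ m] by (intro sum_mono) auto
  moreover have "mat_trace (?R ^\<^sub>m m) = (\<Sum>i<n. ?r i) + (\<Sum>i<p. ?r (n + i))"
  proof -
    have "sum g {..<n + p} = sum g {..<n} + (\<Sum>i<p. g (n + i))" for g :: "nat \<Rightarrow> real"
      by (induction p) (simp_all add: add.assoc)
    thus ?thesis unfolding mat_trace_def pow_mat_dim path_mat_dim .
  qed
  ultimately show ?thesis by linarith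
qed

lemma path_mat_pow_le:
  assumes "i < n" "j < n"
  shows "((path_mat n :: real mat) ^\<^sub>m m) $$ (i, j) \<le> 4 ^ m"
  using assms(2)
proof (induction m arbitrary: j)
  case (Suc m)
  let ?P = "path_mat n :: real mat"
  have "(?P ^\<^sub>m Suc m) $$ (i, j) = (\<Sum>k<n. (?P ^\<^sub>m m) $$ (i, k) * ?P $$ (k, j))"
    by (rule path_mat_pow_Suc_entry[OF assms(1) Suc.prems])
  also have "\<dots> \<le> (\<Sum>k<n. 4 ^ m * ?P $$ (k, j))"
    using Suc by (intro sum_mono mult_right_mono) (auto simp: path_mat_entry)
  also have "\<dots> = 4 ^ m * (\<Sum>k<n. ?P $$ (k, j))" by (simp add: sum_distrib_left)
  also have "(\<Sum>k<n. ?P $$ (k, j)) \<le> (\<Sum>k<n. (if k = j then 2 else 0) + (if k = Suc j then 1 else 0)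
      + (if k = j - 1 then 1 else 0))"
    using Suc.prems by (intro sum_mono) (auto simp: path_mat_entry)
  also have "\<dots> \<le> 4" by (simp add: sum.distrib)
  finally show ?case by simp
qed (use assms(1) in simp)

lemma path_mat_mean_in_W:
  assumes "n \<ge> 1"
  shows "mat_trace ((path_mat n :: real mat) ^\<^sub>m (2 ^ k)) / n \<in> W k"
  unfolding W_def using path_mat_in_S_all[OF assms]
  by (auto simp: mean_Tr_def Tr_eq_mat_trace[OF path_mat_carrier] intro!: bexI[of _ "path_mat n"])

text \<open>
  Superadditivity makes the mean grow strictly whenever the length of the path is doubled.
\<close>

lemma W_has_limit_point:
  assumes "k \<ge> 1"
  shows "\<exists>x. x islimpt W k"
proof -
  let ?m = "2 ^ k :: nat"
  define f where "f n = mat_trace ((path_mat n :: real mat) ^\<^sub>m ?m)" for n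
  define v where "v j = f (2 ^ j) / 2 ^ j" for j :: nat
  have m: "?m \<ge> 2" using assms by (simp add: self_le_power)
  have "v j < v (Suc j)" for j
  proof -
    have "f (2 ^ j) + f (2 ^ j) < f (2 ^ Suc j)"
      unfolding f_def power_Suc mult_2 by (intro path_mat_trace_superadditive m) simp_all
    thus ?thesis by (simp add: v_def field_simps)
  qed
  hence "strict_mono v" by (rule strict_monoI_Suc)
  hence inf: "infinite (range v)" using strict_mono_imp_inj_on range_inj_infinite by blast
  have "\<bar>v j\<bar> \<le> 4 ^ ?m" for j
  proof -
    have "0 \<le> f (2 ^ j)" unfolding f_def mat_trace_def
      by (intro sum_nonneg path_mat_pow_nonneg) auto
    moreover have "f (2 ^ j) \<le> (\<Sum>i<(2 ^ j :: nat). 4 ^ ?m)"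
      unfolding f_def mat_trace_def pow_mat_dim path_mat_dim by (intro sum_mono path_mat_pow_le) auto
    moreover have "(\<Sum>i<(2 ^ j :: nat). 4 ^ ?m) = 2 ^ j * (4 ^ ?m :: real)" by simp
    ultimately have "0 \<le> v j" "v j \<le> 4 ^ ?m" unfolding v_def by (simp_all add: divide_le_eq mult.commute)
    thus ?thesis by simp
  qed
  hence "bounded (range v)" unfolding bounded_iff by auto
  then obtain x where "x islimpt range v" using bounded_infinite_imp_islimpt[OF order_refl _ inf] by blast
  moreover have "range v \<subseteq> W k"
  proof
    fix y assume "y \<in> range v"
    then obtain j where "y = v j" by blast
    thus "y \<in> W k" using path_mat_mean_in_W[of "2 ^ j" k] by (simp add: v_def f_def)
  qed
  ultimately show ?thesis using islimpt_subset by blast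
qed

lemma path_mat_square_sum:
  "(\<Sum>i<Suc n. \<Sum>j<Suc n. ((path_mat (Suc n) :: real mat) $$ (i, j))\<^sup>2) = 6 * real n + 4"
proof (induction n)
  case (Suc n)
  let ?m = "\<lambda>i j. path_mat (Suc (Suc n)) $$ (i, j) :: real"
  have last: "(\<Sum>j<Suc n. (?m j (Suc n))\<^sup>2) = 1" "(\<Sum>j<Suc n. (?m (Suc n) j)\<^sup>2) = 1"
    by (subst sum.mono_neutral_right[of _ "{n}"]; simp add: path_mat_entry)+
  have "(\<Sum>i<Suc (Suc n). \<Sum>j<Suc (Suc n). (?m i j)\<^sup>2)
     = (\<Sum>i<Suc n. \<Sum>j<Suc n. (?m i j)\<^sup>2) + (\<Sum>j<Suc n. (?m j (Suc n))\<^sup>2)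
       + (\<Sum>j<Suc n. (?m (Suc n) j)\<^sup>2) + (?m (Suc n) (Suc n))\<^sup>2"
    unfolding sum.lessThan_Suc[of _ "Suc n"] by (simp only: sum.distrib add.assoc)
  also have "(\<Sum>i<Suc n. \<Sum>j<Suc n. (?m i j)\<^sup>2)
      = (\<Sum>i<Suc n. \<Sum>j<Suc n. ((path_mat (Suc n) :: real mat) $$ (i, j))\<^sup>2)"
    by (intro sum.cong refl) (simp add: path_mat_entry)
  finally show ?case unfolding Suc.IH last by (simp add: path_mat_entry)
qed (simp add: path_mat_entry)

lemma W_1_limit_point: "6 islimpt W 1"
  unfolding islimpt_sequential
proof (intro exI conjI allI)
  let ?v = "\<lambda>n. 6 - 2 * inverse (real (Suc n))"
  show "?v n \<in> W 1 - {6}" for n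
  proof -
    let ?P = "path_mat (Suc n) :: real mat"
    have "transpose_mat ?P = ?P" by (intro eq_matI) (auto simp: path_mat_entry)
    hence "mat_trace (?P ^\<^sub>m (2 ^ 1)) = 6 * real n + 4"
      using mat_trace_square_symmetric[OF path_mat_carrier, of "Suc n"] path_mat_square_sum[of n]
      by (simp add: numeral_2_eq_2)
    hence "mat_trace (?P ^\<^sub>m (2 ^ 1)) / Suc n = ?v n" by (simp add: field_simps)
    thus ?thesis using path_mat_mean_in_W[of "Suc n" 1] by simp
  qed
  show "?v \<longlonglongrightarrow> 6"
    using tendsto_diff[OF tendsto_const[of 6] tendsto_mult[OF tendsto_const[of 2] LIMSEQ_inverse_real_of_nat]]
    by simp
qed

section \<open>The smallest limit points\<close>

 

lemma exists_smallest_limit_point: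
  assumes "x islimpt X" and low: "\<And>x. x islimpt X \<Longrightarrow> b \<le> x"
  obtains m where "smallest_limit_point X m" "b \<le> m"
proof -
  let ?L = "{x. x islimpt X}"
  have bdd: "bdd_below ?L" by (rule bdd_belowI[of _ b]) (use low in blast)
  have "Inf ?L \<in> ?L"
    using assms(1) by (intro closed_contains_Inf bdd closed_limpts) auto
  moreover have "Inf ?L \<le> x" if "x islimpt X" for x
    using that by (intro cInf_lower bdd) auto
  ultimately have "smallest_limit_point X (Inf ?L)" by (simp add: smallest_limit_point_def)
  moreover have "b \<le> Inf ?L" using assms(1) low by (intro cInf_greatest) auto
  ultimately show ?thesis by (rule that)
qed

theorem theorem2:
  shows "smallest_limit_point (W 1) 6 \<and>
    (\<forall>k::nat. k > 1 \<longrightarrow> (\<exists>m. smallest_limit_point (W k) m \<and> m \<ge> 5 ^ (2 ^ (k - 1))))"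
proof (intro conjI allI impI)
  show "smallest_limit_point (W 1) 6"
    using W_1_limit_point W_limit_point_ge[of _ 0] by (simp add: smallest_limit_point_def)
  fix k :: nat assume "k > 1"
  then obtain l where k: "k = Suc l" by (cases k) auto
  obtain x where "x islimpt W k" using W_has_limit_point[of k] k by auto
  then obtain m where m: "smallest_limit_point (W k) m" "6 ^ (2 ^ l) \<le> m"
    by (rule exists_smallest_limit_point) (use W_limit_point_ge k in blast)
  have "(5::real) ^ (2 ^ l) \<le> 6 ^ (2 ^ l)" by (intro power_mono) auto
  hence "(5::real) ^ (2 ^ l) \<le> m" using m(2) by (rule order_trans)
  with m(1) have "smallest_limit_point (W k) m \<and> 5 ^ (2 ^ (k - 1)) \<le> m" by (simp add: k)
  thus "\<exists>m. smallest_limit_point (W k) m \<and> 5 ^ (2 ^ (k - 1)) \<le> m" ..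
qed

end
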